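(* Let $(G,F)$ be a similarity GIFS with $\lambda(f_e)=s^{d(e)}$ for all $e\in E$. If $(G,F)$ is rigid, then there are uncountably many balanced tilings $T(\overleftarrow{\theta})$ for $(G,F)$ (with $\overleftarrow{\theta}$ ranging over the filling parameters) up to congruence.
   Context: GIFS. Let $G=(V,E)$ be a finite strongly connected directed graph with $V=\{1,\dots,n\}$, loops and multiple edges allowed. An edge $e$ goes from its tail $e^-$ to its head $e^+$, and $E_i=\{e\in E: e^-=i\}$. A path is directed, is written as its string of edges, may repeat vertices and edges, and may have length zero (a single vertex); $\sigma^-$ is its starting vertex and, for finite $\sigma$, $\sigma^+$ is its terminal vertex. $\Sigma^*$ is the set of finite paths in $G$. A GIFS $(G,F)$ on $\mathbb{R}^d$ consists of $G$ and an invertible contraction $f_e:\mathbb{R}^d\to\mathbb{R}^d$ for each $e\in E$. For $\sigma=\sigma_1\cdots\sigma_k\in\Sigma^*$ put $f_\sigma=f_{\sigma_1}\circ\cdots\circ f_{\sigma_k}$ (the identity if $k=0$). There is a unique $n$-tuple $(A_1,\dots,A_n)$ of nonempty compact sets (the components of the attractor) with $A_i=\bigcup_{e\in E_i}f_e(A_{e^+})$ for all $i$. Standing assumptions: each $A_i$ has nonempty interior, and for each $i$ and distinct $e,e'\in E_i$ the set $f_e(A_{e^+})\cap f_{e'}(A_{e'^+})$ has empty interior. Tilings. A tile is a compact subset of $\mathbb{R}^d$ with nonempty interior; a tiling of $X\subseteq\mathbb{R}^d$ is a set of tiles, pairwise non-overlapping (the intersection of two distinct tiles has empty interior), whose union is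 $X$. Two tilings are congruent if there is a tile-preserving isometry of $\mathbb{R}^d$ taking one to the other. Pre-trees. A subpath of $\sigma_1\cdots\sigma_k$ is an initial segment $\sigma_1\cdots\sigma_j$ with $0\le j\le k$ (for $j=0$, the single starting vertex); it is proper if $j<k$. A pre-tree is a finite nonempty set $S$ of finite paths in $G$ such that (i) all paths in $S$ begin at the same vertex, the root of $S$; (ii) no proper subpath of a path in $S$ lies in $S$; (iii) if $\sigma$ is a proper subpath of a path in $S$ and $e\in E$ has $e^-=\sigma^+$, then $\sigma e$ is a subpath of a path in $S$. Parameters. Let $\overleftarrow{G}$ be $G$ with all edges reversed, $\overleftarrow{e}$ the reversal of $e$, $\overleftarrow{\Sigma}^*$ and $\overleftarrow{\Sigma}^\infty$ the sets of finite and infinite paths in $\overleftarrow{G}$, $f_{\overleftarrow{e}}=f_e^{-1}$, and $f_{\overleftarrow{e_1}\cdots\overleftarrow{e_k}}=f_{\overleftarrow{e_1}}\circ\cdots\circ f_{\overleftarrow{e_k}}$. A parameter is an element $\overleftarrow{\theta}=\overleftarrow{\theta}_1\overleftarrow{\theta}_2\cdots$ of $\overleftarrow{\Sigma}^\infty$, with successive vertices $v_0,v_1,v_2,\dots$; $\theta_k\in E$ is the edge of $G$ with reversal $\overleftarrow{\theta}_k$ (so $\theta_k$ goes from $v_k$ to $v_{k-1}$), and $\overleftarrow{\theta}|k=\overleftarrow{\theta}_1\cdots\overleftarrow{\theta}_k$. A $\overleftarrow{\theta}$-sequence is a sequence $\mathcal{S}=\{S_0,S_1,\dots\}$ of pre-trees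 such that $S_k$ has root $v_k$ for all $k\ge0$ and $\theta_kS_{k-1}:=\{\theta_k\sigma:\sigma\in S_{k-1}\}\subset S_k$ for all $k\ge1$. Put $T(\overleftarrow{\theta},\mathcal{S},k)=\{f_{\overleftarrow{\theta}|k}\circ f_\sigma(A_{\sigma^+}):\sigma\in S_k\}$ and $T(\overleftarrow{\theta},\mathcal{S})=\bigcup_{k\ge0}T(\overleftarrow{\theta},\mathcal{S},k)$. The parameter $\overleftarrow{\theta}$ is filling if, for every $\overleftarrow{\theta}$-sequence $\mathcal{S}$, the union of the sets in $T(\overleftarrow{\theta},\mathcal{S})$ is $\mathbb{R}^d$. Balanced tilings. Each $f_e$ is a similarity with scaling ratio $\lambda(f_e)$, and there are a fixed real $s>0$ (the scaling constant) and fixed positive integers $d(e)$ with $\lambda(f_e)=s^{d(e)}$ for all $e\in E$. Put $d(\overleftarrow{e})=d(e)$; for a finite path $\sigma$ in $G$ or $\overleftarrow{G}$, $d(\sigma)$ is the sum of the values $d(e)$ over its edges (with multiplicity), and $\sigma_*$ is the last edge of a path $\sigma\in\Sigma^*$ of positive length. The balanced sequence $\mathcal{S}(\overleftarrow{\theta})=(S_0,S_1,\dots)$ has $S_k$ equal to the set of positive-length $\sigma\in\Sigma^*$ with $\sigma^-=v_k$ and $0<d(\sigma)-d(\overleftarrow{\theta}|k)\le d(\sigma_* )$. For filling $\overleftarrow{\theta}$, the balanced GIFS tiling is $T(\overleftarrow{\theta}):=T(\overleftarrow{\theta},\mathcal{S}(\overleftarrow{\theta}))$. Rigidity. For $i\in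 V$ let $B_i=\{f_e(A_{e^+}):e\in E_i\}$. A basic $i$-subdivision is any set of tiles congruent (by an isometry of $\mathbb{R}^d$) to $s^jB_i=\{s^jf_e(A_{e^+}):e\in E_i\}$ for some integer $j$. For a basic subdivision $B$, $\cup B$ is the union of its tiles. $(G,F)$ is rigid if for any basic $i$-subdivision $B$ and any basic $i'$-subdivision $B'$: if $B\cap B'$ (the set of common tiles) is a nonempty set that tiles $(\cup B)\cap(\cup B')$, then $i=i'$ and $B=B'$.
   Formalization: In the definition of rigid, "tiles (∪B)∩(∪B')" is taken up to a set with empty interior instead of exact equality of the union; with exact equality the claim fails, e.g. for f_c(x)=(x+c)/4 on the line, c in {0,1,11,14}. *)

theory Defs
  imports "HOL-Analysis.Analysis" "HOL-Library.Sublist" "Graph_Theory.Graph_Theory"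
begin

section \<open>Maps and tilings\<close>

definition isometry_map :: "('a::metric_space \<Rightarrow> 'a) \<Rightarrow> bool" where
  "isometry_map U \<longleftrightarrow> (\<forall>x y. dist (U x) (U y) = dist x y)"

definition similarity_map :: "real \<Rightarrow> ('a::metric_space \<Rightarrow> 'a) \<Rightarrow> bool" where
  "similarity_map r g \<longleftrightarrow> (\<forall>x y. dist (g x) (g y) = r * dist x y)"

definition contraction_map :: "('a::metric_space \<Rightarrow> 'a) \<Rightarrow> bool" where
  "contraction_map g \<longleftrightarrow> (\<exists>c<1. c-lipschitz_on UNIV g)"

definition is_tile :: "'a::euclidean_space set \<Rightarrow> bool" where
  "is_tile t \<longleftrightarrow> compact t \<and> interior t \<noteq> {}"

text \<open>\<open>T\<close> tiles \<open>X\<close>, where, as in the notion of non-overlapping, sets with empty interior are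
  disregarded: the union of \<open>T\<close> need only exhaust \<open>X\<close> up to a set with empty interior. This is
  the notion needed for rigidity. The intersection of the supports of two finite subsets of one
  and the same tiling may contain, besides the common tiles, stray boundary points at which
  distinct tiles touch. With exact equality \<open>\<Union>T = X\<close> such points would make the rigidity
  condition hold vacuously, for instance for \<open>f_c(x) = (x + c) / 4\<close> on the line with
  \<open>c \<in> {0, 1, 11, 14}\<close>, all of whose balanced tilings are congruent.\<close>

definition tiles_region :: "'a::euclidean_space set set \<Rightarrow> 'a set \<Rightarrow> bool" where
  "tiles_region T X \<longleftrightarrow>
     (\<forall>t\<in>T. is_tile t) \<and> (\<forall>t\<in>T. \<forall>t'\<in>T. t \<noteq> t' \<longrightarrow> interior (t \<inter> t') = {}) \<and>
     \<Union>T \<subseteq> X \<and> interior (X - \<Union>T) = {}"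

definition congruent_sets :: "'a::euclidean_space set set \<Rightarrow> 'a set set \<Rightarrow> bool" where
  "congruent_sets T T' \<longleftrightarrow> (\<exists>U. isometry_map U \<and> T' = (\<lambda>t. U ` t) ` T)"

section \<open>Paths\<close>

text \<open>A finite path is a pair of its starting vertex and its list of edges, so that the
  zero-length paths at different vertices are different.\<close>

type_synonym ('v, 'e) gpath = "'v \<times> 'e list"

definition fin_paths :: "('v, 'e) pre_digraph \<Rightarrow> ('v, 'e) gpath set" where
  "fin_paths G = {(u, p). \<exists>v. pre_digraph.awalk G u p v}"

definition path_end :: "('v, 'e) pre_digraph \<Rightarrow> ('v, 'e) gpath \<Rightarrow> 'v" where
  "path_end G \<sigma> = pre_digraph.awlast G (fst \<sigma>) (snd \<sigma>)"

definition is_subpath :: "('v, 'e) gpath \<Rightarrow> ('v, 'e) gpath \<Rightarrow> bool" where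
  "is_subpath \<tau> \<sigma> \<longleftrightarrow> fst \<tau> = fst \<sigma> \<and> prefix (snd \<tau>) (snd \<sigma>)"

definition is_proper_subpath :: "('v, 'e) gpath \<Rightarrow> ('v, 'e) gpath \<Rightarrow> bool" where
  "is_proper_subpath \<tau> \<sigma> \<longleftrightarrow> fst \<tau> = fst \<sigma> \<and> strict_prefix (snd \<tau>) (snd \<sigma>)"

definition comp_list :: "('e \<Rightarrow> 'a \<Rightarrow> 'a) \<Rightarrow> 'e list \<Rightarrow> 'a \<Rightarrow> 'a" where
  "comp_list f p = foldr (\<lambda>e g. f e \<circ> g) p id"

section \<open>Graph iterated function systems\<close>

definition is_gifs ::
  "(nat, 'e) pre_digraph \<Rightarrow> nat \<Rightarrow> ('e \<Rightarrow> 'a::euclidean_space \<Rightarrow> 'a) \<Rightarrow> bool" where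
  "is_gifs G n f \<longleftrightarrow>
     fin_digraph G \<and> strongly_connected G \<and> verts G = {1..n} \<and>
     (\<forall>e\<in>arcs G. bij (f e) \<and> contraction_map (f e))"

text \<open>The edge set \<open>E_i\<close> is \<^const>\<open>out_arcs\<close>. Only the values of \<open>A\<close> at vertices matter.\<close>

definition is_attractor ::
  "('v, 'e) pre_digraph \<Rightarrow> ('e \<Rightarrow> 'a::euclidean_space \<Rightarrow> 'a) \<Rightarrow> ('v \<Rightarrow> 'a set) \<Rightarrow> bool" where
  "is_attractor G f A \<longleftrightarrow>
     (\<forall>i\<in>verts G. A i \<noteq> {} \<and> compact (A i) \<and> A i = (\<Union>e\<in>out_arcs G i. f e ` A (head G e)))"

definition tile_conditions ::
  "('v, 'e) pre_digraph \<Rightarrow> ('e \<Rightarrow> 'a::euclidean_space \<Rightarrow> 'a) \<Rightarrow> ('v \<Rightarrow> 'a set) \<Rightarrow> bool" where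
  "tile_conditions G f A \<longleftrightarrow>
     (\<forall>i\<in>verts G. interior (A i) \<noteq> {}) \<and>
     (\<forall>i\<in>verts G. \<forall>e\<in>out_arcs G i. \<forall>e'\<in>out_arcs G i. e \<noteq> e' \<longrightarrow>
        interior (f e ` A (head G e) \<inter> f e' ` A (head G e')) = {})"

section \<open>Pre-trees, parameters and tilings\<close>

definition is_pretree :: "('v, 'e) pre_digraph \<Rightarrow> 'v \<Rightarrow> ('v, 'e) gpath set \<Rightarrow> bool" where
  "is_pretree G r S \<longleftrightarrow>
     finite S \<and> S \<noteq> {} \<and> S \<subseteq> fin_paths G \<and>
     (\<forall>\<sigma>\<in>S. fst \<sigma> = r) \<and>
     (\<forall>\<sigma>\<in>S. \<forall>\<tau>. is_proper_subpath \<tau> \<sigma> \<longrightarrow> \<tau> \<notin> S) \<and>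
     (\<forall>\<sigma>\<in>S. \<forall>\<tau>. is_proper_subpath \<tau> \<sigma> \<longrightarrow>
        (\<forall>e\<in>out_arcs G (path_end G \<tau>). \<exists>\<rho>\<in>S. is_subpath (fst \<tau>, snd \<tau> @ [e]) \<rho>))"

definition reverse_digraph :: "('v, 'e) pre_digraph \<Rightarrow> ('v, 'e) pre_digraph" where
  "reverse_digraph G = \<lparr>verts = verts G, arcs = arcs G, tail = head G, head = tail G\<rparr>"

definition is_inf_path :: "('v, 'e) pre_digraph \<Rightarrow> (nat \<Rightarrow> 'e) \<Rightarrow> bool" where
  "is_inf_path H p \<longleftrightarrow> (\<forall>k. p k \<in> arcs H \<and> head H (p k) = tail H (p (Suc k)))"

text \<open>A reversed edge carries the same name as the original edge. Edge sequences are indexed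
  from 0, so \<open>\<theta> k\<close> is the edge written \<open>\<theta>_(k+1)\<close> when counting from 1.\<close>

definition is_parameter :: "('v, 'e) pre_digraph \<Rightarrow> (nat \<Rightarrow> 'e) \<Rightarrow> bool" where
  "is_parameter G \<theta> \<longleftrightarrow> is_inf_path (reverse_digraph G) \<theta>"

definition param_vertex :: "('v, 'e) pre_digraph \<Rightarrow> (nat \<Rightarrow> 'e) \<Rightarrow> nat \<Rightarrow> 'v" where
  "param_vertex G \<theta> k =
     (case k of 0 \<Rightarrow> tail (reverse_digraph G) (\<theta> 0) | Suc j \<Rightarrow> head (reverse_digraph G) (\<theta> j))"

definition param_take :: "(nat \<Rightarrow> 'e) \<Rightarrow> nat \<Rightarrow> 'e list" where
  "param_take \<theta> k = map \<theta> [0..<k]"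

definition prepend_edge :: "('v, 'e) pre_digraph \<Rightarrow> 'e \<Rightarrow> ('v, 'e) gpath \<Rightarrow> ('v, 'e) gpath" where
  "prepend_edge G e \<sigma> = (tail G e, e # snd \<sigma>)"

definition is_param_sequence ::
  "('v, 'e) pre_digraph \<Rightarrow> (nat \<Rightarrow> 'e) \<Rightarrow> (nat \<Rightarrow> ('v, 'e) gpath set) \<Rightarrow> bool" where
  "is_param_sequence G \<theta> S \<longleftrightarrow>
     (\<forall>k. is_pretree G (param_vertex G \<theta> k) (S k)) \<and>
     (\<forall>k. prepend_edge G (\<theta> k) ` S k \<subseteq> S (Suc k))"

definition level_tiles ::
  "('v, 'e) pre_digraph \<Rightarrow> ('e \<Rightarrow> 'a::euclidean_space \<Rightarrow> 'a) \<Rightarrow> ('v \<Rightarrow> 'a set) \<Rightarrow>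
   (nat \<Rightarrow> 'e) \<Rightarrow> (nat \<Rightarrow> ('v, 'e) gpath set) \<Rightarrow> nat \<Rightarrow> 'a set set" where
  "level_tiles G f A \<theta> S k =
     (\<lambda>\<sigma>. (comp_list (\<lambda>e. inv (f e)) (param_take \<theta> k) \<circ> comp_list f (snd \<sigma>)) ` A (path_end G \<sigma>))
       ` S k"

definition all_tiles ::
  "('v, 'e) pre_digraph \<Rightarrow> ('e \<Rightarrow> 'a::euclidean_space \<Rightarrow> 'a) \<Rightarrow> ('v \<Rightarrow> 'a set) \<Rightarrow>
   (nat \<Rightarrow> 'e) \<Rightarrow> (nat \<Rightarrow> ('v, 'e) gpath set) \<Rightarrow> 'a set set" where
  "all_tiles G f A \<theta> S = (\<Union>k. level_tiles G f A \<theta> S k)"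

definition is_filling ::
  "('v, 'e) pre_digraph \<Rightarrow> ('e \<Rightarrow> 'a::euclidean_space \<Rightarrow> 'a) \<Rightarrow> ('v \<Rightarrow> 'a set) \<Rightarrow>
   (nat \<Rightarrow> 'e) \<Rightarrow> bool" where
  "is_filling G f A \<theta> \<longleftrightarrow>
     is_parameter G \<theta> \<and> (\<forall>S. is_param_sequence G \<theta> S \<longrightarrow> \<Union>(all_tiles G f A \<theta> S) = UNIV)"

section \<open>Balanced tilings and rigidity\<close>

definition path_deg :: "('e \<Rightarrow> nat) \<Rightarrow> 'e list \<Rightarrow> nat" where
  "path_deg d p = sum_list (map d p)"

definition balanced_sequence ::
  "('v, 'e) pre_digraph \<Rightarrow> ('e \<Rightarrow> nat) \<Rightarrow> (nat \<Rightarrow> 'e) \<Rightarrow> nat \<Rightarrow> ('v, 'e) gpath set" where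
  "balanced_sequence G d \<theta> k =
     {\<sigma> \<in> fin_paths G. snd \<sigma> \<noteq> [] \<and> fst \<sigma> = param_vertex G \<theta> k \<and>
        0 < int (path_deg d (snd \<sigma>)) - int (path_deg d (param_take \<theta> k)) \<and>
        int (path_deg d (snd \<sigma>)) - int (path_deg d (param_take \<theta> k)) \<le> int (d (last (snd \<sigma>)))}"

definition balanced_tiling ::
  "('v, 'e) pre_digraph \<Rightarrow> ('e \<Rightarrow> 'a::euclidean_space \<Rightarrow> 'a) \<Rightarrow> ('v \<Rightarrow> 'a set) \<Rightarrow>
   ('e \<Rightarrow> nat) \<Rightarrow> (nat \<Rightarrow> 'e) \<Rightarrow> 'a set set" where
  "balanced_tiling G f A d \<theta> = all_tiles G f A \<theta> (balanced_sequence G d \<theta>)"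

definition scaled_tiles ::
  "('v, 'e) pre_digraph \<Rightarrow> ('e \<Rightarrow> 'a::euclidean_space \<Rightarrow> 'a) \<Rightarrow> ('v \<Rightarrow> 'a set) \<Rightarrow>
   real \<Rightarrow> int \<Rightarrow> 'v \<Rightarrow> 'a set set" where
  "scaled_tiles G f A s j i =
     (\<lambda>e. (\<lambda>x. (s powi j) *\<^sub>R x) ` (f e ` A (head G e))) ` out_arcs G i"

definition basic_subdivision ::
  "('v, 'e) pre_digraph \<Rightarrow> ('e \<Rightarrow> 'a::euclidean_space \<Rightarrow> 'a) \<Rightarrow> ('v \<Rightarrow> 'a set) \<Rightarrow>
   real \<Rightarrow> 'v \<Rightarrow> 'a set set \<Rightarrow> bool" where
  "basic_subdivision G f A s i B \<longleftrightarrow> (\<exists>j. congruent_sets (scaled_tiles G f A s j i) B)"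

definition is_rigid ::
  "('v, 'e) pre_digraph \<Rightarrow> ('e \<Rightarrow> 'a::euclidean_space \<Rightarrow> 'a) \<Rightarrow> ('v \<Rightarrow> 'a set) \<Rightarrow>
   real \<Rightarrow> bool" where
  "is_rigid G f A s \<longleftrightarrow>
     (\<forall>i\<in>verts G. \<forall>i'\<in>verts G. \<forall>B B'.
        basic_subdivision G f A s i B \<longrightarrow> basic_subdivision G f A s i' B' \<longrightarrow>
        B \<inter> B' \<noteq> {} \<longrightarrow> tiles_region (B \<inter> B') (\<Union>B \<inter> \<Union>B') \<longrightarrow> i = i' \<and> B = B')"

end

theory Submission
  imports Defs
begin

text \<open>
  A balanced tiling is the bottom layer of a hierarchy. The supertiles
  \<open>f_(\<theta>|k) (f_\<sigma> (A_i))\<close>, with \<open>\<sigma>\<close> a path from \<open>v_k\<close> to \<open>i\<close>, form a tree without a top: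
  each one is subdivided into its children, and the main supertiles \<open>f_(\<theta>|k) (A_(v_k))\<close> form an
  ascending chain that passes above every node. A supertile is a copy of \<open>A_i\<close> scaled by
  \<open>s^a\<close>, and the tiles of the tiling are the first ones on each descending path with \<open>a > 0\<close>.

  Rigidity makes this hierarchy visible in the tiling (\<open>supertiles_determined_by_leaves\<close>): if
  two hierarchies have the same tiles, every supertile of the first with exponent \<open>a \<le> 0\<close> is a
  supertile of the second with the same exponent. By induction on \<open>-a\<close>, the children of the
  given supertile that are not tiles already are nodes of the second hierarchy too. Among the
  parents of all the children there, take one, \<open>p\<close>, with the largest exponent. The maximal choice prevents any of the given children from lying
  strictly inside a child of \<open>p\<close>, so the two basic subdivisions overlap exactly in their
  common tiles; rigidity says that they coincide.

  Consequently, if \<open>T(\<theta>)\<close> and \<open>T(\<theta>')\<close> are congruent, then the isometry carries the chain of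
  main supertiles of \<open>\<theta>\<close> to that of \<open>\<theta>'\<close>, up to a shift of the index and from some level on
  (\<open>congruent_balanced_tilings_merge\<close>). The edges of \<open>\<theta>\<close> and \<open>\<theta>'\<close> need not agree, because a
  subdivision may have symmetries. A congruence-invariant quantity is the speed at which the
  chain grows: how many levels above \<open>j\<close> one has to go until the supertile of level \<open>j\<close> lies in
  the interior of the larger supertile. This speed can be prescribed to be arbitrarily slow
  infinitely often (\<open>slowly_escaping_parameter\<close>): long stretches of the parameter follow the
  address of a frontier point of some \<open>A_i\<close>, and a loop that maps \<open>A_i\<close> into its own interior,
  inserted between them, makes the parameter filling. Given countably many congruence classes,
  a diagonal argument produces a filling parameter that escapes more slowly, infinitely often,
  than all shifts of the representatives, so that its tiling lies in none of the classes.
\<close>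

section \<open>Similarities\<close>

lemma similarity_continuous:
  assumes "similarity_map r g" "r > 0"
  shows "continuous_on S g"
proof -
  have "r-lipschitz_on S g"
    using assms by (auto simp: lipschitz_on_def similarity_map_def)
  then show ?thesis by (rule lipschitz_on_continuous_on)
qed

lemma similarity_inv:
  assumes "similarity_map r g" "bij g" "r > 0"
  shows "similarity_map (1 / r) (inv g)"
  unfolding similarity_map_def
proof (intro allI)
  fix x y
  have "dist (g (inv g x)) (g (inv g y)) = r * dist (inv g x) (inv g y)"
    using assms(1) by (simp add: similarity_map_def)
  moreover have "g (inv g x) = x" "g (inv g y) = y"
    using assms(2) by (simp_all add: bij_is_surj surj_f_inv_f)
  ultimately show "dist (inv g x) (inv g y) = 1 / r * dist x y"
    using assms(3) by simp
qed

lemma similarity_comp: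
  assumes "similarity_map r g" "similarity_map q h"
  shows "similarity_map (r * q) (g \<circ> h)"
  using assms by (simp add: similarity_map_def)

lemma interior_image_similarity:
  fixes g :: "'a::euclidean_space \<Rightarrow> 'a"
  assumes "similarity_map r g" "bij g" "r > 0"
  shows "interior (g ` S) = g ` interior S"
proof
  have op: "open (g ` X)" if "open X" for X
  proof -
    have "g ` X = inv g -` X" using assms(2) by (simp add: bij_vimage_eq_inv_image bij_imp_bij_inv inv_inv_eq)
    moreover have "continuous_on UNIV (inv g)"
      using similarity_continuous[OF similarity_inv[OF assms]] assms(3) by simp
    ultimately show ?thesis using that open_vimage by metis
  qed
  show "g ` interior S \<subseteq> interior (g ` S)"
    by (intro interior_maximal image_mono interior_subset op open_interior)
  have cont: "continuous_on UNIV g" using assms(1,3) by (rule similarity_continuous)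
  have "g -` interior (g ` S) \<subseteq> interior S"
  proof (rule interior_maximal)
    show "g -` interior (g ` S) \<subseteq> S"
      using interior_subset assms(2) by (metis bij_def inj_vimage_image_eq vimage_mono)
    show "open (g -` interior (g ` S))" using cont open_interior open_vimage by blast
  qed
  then show "interior (g ` S) \<subseteq> g ` interior S"
    using assms(2) by (metis bij_def image_mono surj_image_vimage_eq)
qed

lemma isometry_map_bij:
  fixes U :: "'a::euclidean_space \<Rightarrow> 'a"
  assumes "isometry_map U"
  shows "bij U"
proof -
  define L where "L x = U x - U 0" for x
  have "orthogonal_transformation L"
    using assms unfolding orthogonal_transformation_isometry L_def isometry_map_def by (simp add: dist_norm)
  then have "bij L" by (rule orthogonal_transformation_bij)
  moreover have "U = (\<lambda>y. y + U 0) \<circ> L" by (auto simp: L_def)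
  moreover have "bij (\<lambda>y. y + U 0)" by (rule bij_betw_byWitness[where f' = "\<lambda>y. y - U 0"]) auto
  ultimately show ?thesis by (metis bij_comp)
qed

lemma diameter_image_similarity:
  fixes g :: "'a::euclidean_space \<Rightarrow> 'a"
  assumes "similarity_map r g" "r > 0" "bounded S"
  shows "diameter (g ` S) = r * diameter S"
proof (cases "S = {}")
  case True
  then show ?thesis by (simp add: diameter_def)
next
  case False
  have d: "dist (g x) (g y) = r * dist x y" for x y
    using assms(1) by (simp add: similarity_map_def)
  have bg: "bounded (g ` S)"
    using assms(3) bounded_uniformly_continuous_image[of S g]
      lipschitz_on_uniformly_continuous[of r S g] assms(2) by (simp add: lipschitz_on_def d)
  show ?thesis
  proof (rule antisym)
    show "diameter (g ` S) \<le> r * diameter S"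
    proof (rule diameter_le)
      show "g ` S \<noteq> {} \<or> 0 \<le> r * diameter S" using False by simp
      fix x y assume "x \<in> g ` S" "y \<in> g ` S"
      then obtain u v where "u \<in> S" "v \<in> S" "x = g u" "y = g v" by auto
      then show "norm (x - y) \<le> r * diameter S"
        using diameter_bounded_bound[OF assms(3), of u v] d[of u v] assms(2) by (simp add: dist_norm)
    qed
    have "diameter S \<le> diameter (g ` S) / r"
    proof (rule diameter_le)
      show "S \<noteq> {} \<or> 0 \<le> diameter (g ` S) / r" using False by simp
      fix u v assume "u \<in> S" "v \<in> S"
      then have "dist (g u) (g v) \<le> diameter (g ` S)"
        by (intro diameter_bounded_bound[OF bg]) auto
      then show "norm (u - v) \<le> diameter (g ` S) / r"
        using d[of u v] assms(2) by (simp add: dist_norm field_simps)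
    qed
    then show "r * diameter S \<le> diameter (g ` S)" using assms(2) by (simp add: field_simps)
  qed
qed

lemma interior_Union_empty:
  assumes "finite \<F>" "\<And>S. S \<in> \<F> \<Longrightarrow> closed S" "\<And>S. S \<in> \<F> \<Longrightarrow> interior S = {}"
  shows "interior (\<Union>\<F>) = {}"
  using assms by (induction) (auto simp: interior_closed_Un_empty_interior)

section \<open>Pieces of the attractor\<close>

lemma comp_list_simps [simp]:
  "comp_list f [] = id" "comp_list f (e # p) = f e \<circ> comp_list f p"
  by (simp_all add: comp_list_def)

lemma comp_list_append: "comp_list f (p @ q) = comp_list f p \<circ> comp_list f q"
  by (induction p) (simp_all add: comp_assoc)

lemma path_deg_simps [simp]:
  "path_deg d [] = 0" "path_deg d (e # p) = d e + path_deg d p"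
  "path_deg d (p @ q) = path_deg d p + path_deg d q" "path_deg d (rev p) = path_deg d p"
  by (simp_all add: path_deg_def rev_map[symmetric])

text \<open>The setting in which a single hierarchy is studied; rigidity is assumed where two of them
  are compared.\<close>

locale balanced_gifs = fin_digraph G for G :: "('v, 'e) pre_digraph" +
  fixes f :: "'e \<Rightarrow> 'a::euclidean_space \<Rightarrow> 'a"
    and A :: "'v \<Rightarrow> 'a set" and s :: real and d :: "'e \<Rightarrow> nat"
  assumes strong: "strongly_connected G"
    and bij_f: "e \<in> arcs G \<Longrightarrow> bij (f e)"
    and sim_f: "e \<in> arcs G \<Longrightarrow> similarity_map (s ^ d e) (f e)"
    and s_pos: "s > 0" and s_less_1: "s < 1"
    and d_pos: "e \<in> arcs G \<Longrightarrow> d e > 0"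
    and attractor: "is_attractor G f A"
    and tile_conds: "tile_conditions G f A"
begin

lemma attractor_eq: "i \<in> verts G \<Longrightarrow> A i = (\<Union>e\<in>out_arcs G i. f e ` A (head G e))"
  and compact_A: "i \<in> verts G \<Longrightarrow> compact (A i)"
  using attractor unfolding is_attractor_def by blast+

lemma interior_A: "i \<in> verts G \<Longrightarrow> interior (A i) \<noteq> {}"
  using tile_conds by (auto simp: tile_conditions_def)

lemma nonoverlap_A:
  "e \<in> out_arcs G i \<Longrightarrow> e' \<in> out_arcs G i \<Longrightarrow> e \<noteq> e' \<Longrightarrow>
    interior (f e ` A (head G e) \<inter> f e' ` A (head G e')) = {}"
  using tile_conds by (fastforce simp: tile_conditions_def)

text \<open>Being a path from \<open>u\<close> is stated without naming the end vertex, so that it unfolds along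
  the list of edges.\<close>

definition path_from :: "'v \<Rightarrow> 'e list \<Rightarrow> bool" where
  "path_from u p \<longleftrightarrow> awalk u p (awlast u p)"

lemma fin_paths_iff: "(u, p) \<in> fin_paths G \<longleftrightarrow> path_from u p"
  unfolding fin_paths_def path_from_def by auto

lemma path_from_Nil [simp]: "path_from u [] \<longleftrightarrow> u \<in> verts G"
  by (simp add: path_from_def awalk_Nil_iff)

lemma path_from_Cons [simp]:
  "path_from u (e # p) \<longleftrightarrow> e \<in> out_arcs G u \<and> path_from (head G e) p"
  by (auto simp: path_from_def awalk_def)

lemma awlast_append: "awlast u (p @ q) = awlast (awlast u p) q"
  by (induction p arbitrary: u) auto

lemma path_from_append:
  "path_from u (p @ q) \<longleftrightarrow> path_from u p \<and> path_from (awlast u p) q"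
proof (induction p arbitrary: u)
  case Nil
  then show ?case by (cases q) auto
qed auto

lemma awlast_verts: "path_from u p \<Longrightarrow> awlast u p \<in> verts G"
  by (induction p arbitrary: u) auto

lemma similarity_path:
  "path_from u p \<Longrightarrow> similarity_map (s ^ path_deg d p) (comp_list f p)"
proof (induction p arbitrary: u)
  case Nil
  then show ?case by (simp add: similarity_map_def)
next
  case (Cons e p)
  then have "similarity_map (s ^ d e) (f e)" "similarity_map (s ^ path_deg d p) (comp_list f p)"
    using sim_f by auto
  from similarity_comp[OF this] show ?case by (simp add: power_add comp_def)
qed

lemma bij_path: "path_from u p \<Longrightarrow> bij (comp_list f p)"
proof (induction p arbitrary: u)
  case (Cons e p)
  then have "bij (f e)" "bij (comp_list f p)" using bij_f by auto
  then show ?case by (simp only: comp_list_simps) (rule bij_comp)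
qed simp

definition piece :: "'v \<Rightarrow> 'e list \<Rightarrow> 'a set" where
  "piece u p = comp_list f p ` A (awlast u p)"

lemma piece_Nil [simp]: "piece u [] = A u"
  by (simp add: piece_def)

lemma piece_Cons [simp]: "piece u (e # p) = f e ` piece (head G e) p"
  by (simp add: piece_def image_comp)

lemma piece_append: "piece u (p @ q) = comp_list f p ` piece (awlast u p) q"
  by (simp add: piece_def comp_list_append awlast_append image_comp)

lemma piece_subset: "path_from u p \<Longrightarrow> piece u p \<subseteq> A u"
proof (induction p arbitrary: u)
  case (Cons e p)
  then have "piece (head G e) p \<subseteq> A (head G e)" "e \<in> out_arcs G u" "u \<in> verts G"
    by auto
  then show ?case unfolding attractor_eq[OF \<open>u \<in> verts G\<close>] piece_Cons by blast
qed simp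

lemma piece_antimono: "path_from u (p @ q) \<Longrightarrow> piece u (p @ q) \<subseteq> piece u p"
  using piece_subset[of "awlast u p" q]
  unfolding piece_append piece_def[of u p] path_from_append by (intro image_mono) blast

text \<open>The pieces of the attractor form a tree: non-overlap of the first-level pieces propagates
  to any two paths that separate, because the maps along their common part are homeomorphisms.\<close>

lemma path_cases:
  assumes "path_from u p" "path_from u q"
  shows "prefix p q \<or> prefix q p \<or> interior (piece u p \<inter> piece u q) = {}"
  using assms
proof (induction p arbitrary: u q)
  case (Cons e p)
  show ?case
  proof (cases q)
    case (Cons e' q')
    have e: "e \<in> out_arcs G u" "e' \<in> out_arcs G u" "path_from (head G e) p" "path_from (head G e') q'"
      using Cons.prems Cons by auto
    show ?thesis
    proof (cases "e = e'")
      case True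
      have fe: "bij (f e)" "similarity_map (s ^ d e) (f e)" "s ^ d e > 0"
        using e bij_f sim_f s_pos by auto
      have "piece u (e # p) \<inter> piece u q = f e ` (piece (head G e) p \<inter> piece (head G e) q')"
        using fe(1) unfolding Cons True[symmetric] piece_Cons by (simp add: image_Int bij_is_inj)
      then have "interior (piece u (e # p) \<inter> piece u q)
          = f e ` interior (piece (head G e) p \<inter> piece (head G e) q')"
        using interior_image_similarity[OF fe(2,1,3)] by simp
      moreover have "prefix p q' \<or> prefix q' p
          \<or> interior (piece (head G e) p \<inter> piece (head G e) q') = {}"
        using Cons.IH e True by blast
      ultimately show ?thesis unfolding Cons True by auto
    next
      case False
      have "piece u (e # p) \<inter> piece u (e' # q') \<subseteq> f e ` A (head G e) \<inter> f e' ` A (head G e')"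
        using e piece_subset by fastforce
      then show ?thesis
        using nonoverlap_A[OF e(1,2) False] Cons interior_mono by blast
    qed
  qed simp
qed simp

section \<open>Nodes and their basic subdivisions\<close>

text \<open>A node stands for a supertile together with the way it arises: a similarity \<open>g\<close>, a vertex
  \<open>i\<close> and the exponent \<open>a\<close> of its ratio \<open>s^a\<close>; the supertile is \<open>g (A_i)\<close>. The region alone
  would not do, since a vertex with a single outgoing edge has a child of the same region.\<close>

type_synonym (in -) ('v, 'a) node = "('a \<Rightarrow> 'a) \<times> 'v \<times> int"

abbreviation (in -) vertex :: "('v, 'a) node \<Rightarrow> 'v" where "vertex z \<equiv> fst (snd z)"
abbreviation (in -) expo :: "('v, 'a) node \<Rightarrow> int" where "expo z \<equiv> snd (snd z)"

definition region :: "('v, 'a) node \<Rightarrow> 'a set" where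
  "region z = fst z ` A (vertex z)"

definition proper_node :: "('v, 'a) node \<Rightarrow> bool" where
  "proper_node z \<longleftrightarrow> similarity_map (s powi expo z) (fst z) \<and> bij (fst z) \<and> vertex z \<in> verts G"

definition descend :: "('v, 'a) node \<Rightarrow> 'e list \<Rightarrow> ('v, 'a) node" where
  "descend z p = (fst z \<circ> comp_list f p, awlast (vertex z) p, expo z + int (path_deg d p))"

lemma descend_simps [simp]:
  "fst (descend z p) = fst z \<circ> comp_list f p"
  "vertex (descend z p) = awlast (vertex z) p"
  "expo (descend z p) = expo z + int (path_deg d p)"
  by (simp_all add: descend_def)

lemma descend_Nil: "descend z [] = z"
  by (simp add: descend_def)

lemma descend_append: "descend (descend z p) q = descend z (p @ q)"
  by (simp add: descend_def comp_list_append awlast_append comp_assoc)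

lemma proper_descend:
  assumes "proper_node z" "path_from (vertex z) p"
  shows "proper_node (descend z p)"
proof -
  have "s powi expo z * s ^ path_deg d p = s powi (expo z + int (path_deg d p))"
    using s_pos by (simp add: power_int_add)
  then show ?thesis
    using assms similarity_comp[OF _ similarity_path, of "s powi expo z" "fst z" "vertex z" p]
      bij_comp[OF bij_path, of "vertex z" p "fst z"] awlast_verts
    by (simp add: proper_node_def)
qed

lemma region_descend: "region (descend z p) = fst z ` piece (vertex z) p"
  by (simp add: region_def piece_def image_comp)

lemma interior_region_image:
  assumes "proper_node z"
  shows "interior (fst z ` X) = fst z ` interior X"
  using assms s_pos interior_image_similarity[of "s powi expo z" "fst z" X]
  by (simp add: proper_node_def)

lemma is_tile_region:
  assumes "proper_node z"
  shows "is_tile (region z)"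
  unfolding is_tile_def region_def interior_region_image[OF assms]
  using assms interior_A[of "vertex z"] compact_A[of "vertex z"]
  by (auto simp: proper_node_def s_pos
      intro!: compact_continuous_image similarity_continuous[of "s powi expo z"])

lemma descend_cases:
  assumes "proper_node z" "path_from (vertex z) p" "path_from (vertex z) q"
  shows "prefix p q \<or> prefix q p \<or> interior (region (descend z p) \<inter> region (descend z q)) = {}"
proof -
  have "region (descend z p) \<inter> region (descend z q) = fst z ` (piece (vertex z) p \<inter> piece (vertex z) q)"
    using assms(1) by (simp add: region_descend proper_node_def image_Int bij_is_inj)
  then show ?thesis
    using path_cases[OF assms(2,3)] interior_region_image[OF assms(1)] by auto
qed

lemma region_descend_antimono:
  assumes "path_from (vertex z) (p @ q)"
  shows "region (descend z (p @ q)) \<subseteq> region (descend z p)"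
  using piece_antimono[OF assms] by (auto simp: region_descend)

definition children :: "('v, 'a) node \<Rightarrow> 'a set set" where
  "children z = (\<lambda>e. region (descend z [e])) ` out_arcs G (vertex z)"

lemma Union_children: "vertex z \<in> verts G \<Longrightarrow> \<Union>(children z) = region z"
  using attractor_eq[of "vertex z"] by (auto simp: children_def region_def image_comp)

lemma finite_children: "finite (children z)"
  by (simp add: children_def finite_out_arcs)

text \<open>Undoing the scaling by \<open>s^a\<close> about the origin turns the similarity of a node into an
  isometry.\<close>

lemma basic_subdivision_children:
  assumes "proper_node z"
  shows "basic_subdivision G f A s (vertex z) (children z)"
proof -
  define U where "U = fst z \<circ> (\<lambda>x. (s powi (- expo z)) *\<^sub>R x)"
  have dist_z: "dist (fst z x) (fst z y) = s powi expo z * dist x y" for x y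
    using assms by (simp add: proper_node_def similarity_map_def)
  have "s powi expo z \<noteq> 0" using s_pos by simp
  moreover have "dist (c *\<^sub>R x) (c *\<^sub>R y) = \<bar>c\<bar> * dist x y" for c :: real and x y :: 'a
    by (simp add: dist_norm scaleR_diff_right[symmetric] del: scaleR_diff_right)
  ultimately have "isometry_map U"
    using s_pos by (simp add: isometry_map_def U_def dist_z power_int_minus)
  moreover have "U ((s powi expo z) *\<^sub>R x) = fst z x" for x
    using s_pos by (simp add: U_def power_int_minus)
  then have "children z = (\<lambda>t. U ` t) ` scaled_tiles G f A s (expo z) (vertex z)"
    unfolding children_def scaled_tiles_def region_def by (simp add: image_image)
  ultimately show ?thesis
    unfolding basic_subdivision_def congruent_sets_def by blast
qed

lemma siblings_nonoverlap:
  assumes "proper_node z" "e \<in> out_arcs G (vertex z)" "e' \<in> out_arcs G (vertex z)" "e \<noteq> e'"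
  shows "interior (region (descend z [e]) \<inter> region (descend z [e'])) = {}"
  using descend_cases[of z "[e]" "[e']"] assms by auto

lemma is_tile_children:
  assumes "proper_node z" "t \<in> children z"
  shows "is_tile t"
proof -
  obtain e where "e \<in> out_arcs G (vertex z)" "t = region (descend z [e])"
    using assms(2) by (auto simp: children_def)
  then show ?thesis using proper_descend[OF assms(1), of "[e]"] is_tile_region by simp
qed

lemma interior_region: "proper_node z \<Longrightarrow> interior (region z) \<noteq> {}"
  using is_tile_region by (auto simp: is_tile_def)

lemma out_arcs_nonempty:
  assumes "i \<in> verts G"
  shows "out_arcs G i \<noteq> {}"
  using attractor_eq[OF assms] interior_A[OF assms] by auto

lemma diameter_A_pos:
  assumes "i \<in> verts G"
  shows "diameter (A i) > 0"
proof -
  obtain x r where "r > 0" "cball x r \<subseteq> A i"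
    using interior_A[OF assms] by (auto simp: mem_interior_cball)
  moreover have "bounded (A i)" using compact_A[OF assms] by (rule compact_imp_bounded)
  ultimately have "diameter (cball x r) \<le> diameter (A i)"
    by (intro diameter_subset) auto
  then show ?thesis using \<open>r > 0\<close> by (simp add: diameter_cball)
qed

text \<open>For a fixed vertex, the diameter of a region reveals the exponent, as \<open>s < 1\<close>.\<close>

lemma expo_eq_of_region_eq:
  assumes "proper_node z" "proper_node w" "vertex z = vertex w" "region z = region w"
  shows "expo z = expo w"
proof -
  have diam: "diameter (region y) = s powi expo y * diameter (A (vertex y))" if "proper_node y" for y
    using that s_pos compact_A[of "vertex y"] compact_imp_bounded unfolding proper_node_def region_def
    by (intro diameter_image_similarity) auto
  have "diameter (A (vertex w)) > 0" using assms(2) diameter_A_pos by (simp add: proper_node_def)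
  then have "s powi expo z = s powi expo w"
    using diam[OF assms(1)] diam[OF assms(2)] assms(3,4) by simp
  then show ?thesis
    using s_pos s_less_1 power_int_strict_decreasing[of _ _ s] by (metis less_irrefl linorder_neqE)
qed

text \<open>What the two subdivisions share besides their common tiles is contained in the finitely many
  intersections of distinct tiles, which are closed sets with empty interior.\<close>

lemma tiles_region_common_tiles:
  fixes B B' :: "'a set set"
  assumes "finite B" "finite B'" "\<And>t. t \<in> B \<union> B' \<Longrightarrow> is_tile t"
    and "\<And>t t'. t \<in> B \<Longrightarrow> t' \<in> B \<Longrightarrow> t \<noteq> t' \<Longrightarrow> interior (t \<inter> t') = {}"
    and "\<And>t t'. t \<in> B \<Longrightarrow> t' \<in> B' \<Longrightarrow> t \<noteq> t' \<Longrightarrow> interior (t \<inter> t') = {}"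
  shows "tiles_region (B \<inter> B') (\<Union>B \<inter> \<Union>B')"
proof -
  define \<F> where "\<F> = {t \<inter> t' |t t'. t \<in> B \<and> t' \<in> B' \<and> t \<noteq> t'}"
  have "\<F> \<subseteq> (\<lambda>(t, t'). t \<inter> t') ` (B \<times> B')" by (auto simp: \<F>_def)
  then have "finite \<F>" using assms(1,2) by (meson finite_SigmaI finite_imageI finite_subset)
  moreover have "closed S \<and> interior S = {}" if "S \<in> \<F>" for S
  proof -
    obtain t t' where t: "S = t \<inter> t'" "t \<in> B" "t' \<in> B'" "t \<noteq> t'" using \<open>S \<in> \<F>\<close> \<F>_def by blast
    then have "is_tile t" "is_tile t'" using assms(3) by blast+
    then have "closed S" using t(1) by (simp add: is_tile_def compact_imp_closed closed_Int)
    then show ?thesis using assms(5)[OF t(2-4)] t(1) by simp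
  qed
  ultimately have "interior (\<Union>\<F>) = {}" by (intro interior_Union_empty) auto
  moreover have "\<Union>B \<inter> \<Union>B' - \<Union>(B \<inter> B') \<subseteq> \<Union>\<F>" by (auto simp: \<F>_def)
  ultimately have "interior (\<Union>B \<inter> \<Union>B' - \<Union>(B \<inter> B')) = {}" using interior_mono by blast
  then show ?thesis using assms(3,4) unfolding tiles_region_def by blast
qed

section \<open>Towers of supertiles\<close>

text \<open>The main supertiles of a parameter, stripped of how they arise. A finite descending path
  from a sufficiently high member of the tower leads to any node of its hierarchy. Composing the
  maps of a tower with an isometry gives a tower again, which is how congruent tilings are
  compared.\<close>

definition tower :: "(nat \<Rightarrow> ('v, 'a) node) \<Rightarrow> (nat \<Rightarrow> 'e) \<Rightarrow> bool" where
  "tower x \<theta> \<longleftrightarrow> (\<forall>k. proper_node (x k) \<and> \<theta> k \<in> out_arcs G (vertex (x (Suc k))) \<and>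
     x k = descend (x (Suc k)) [\<theta> k])"

lemma tower_proper: "tower x \<theta> \<Longrightarrow> proper_node (x k)"
  and tower_arc: "tower x \<theta> \<Longrightarrow> \<theta> k \<in> out_arcs G (vertex (x (Suc k)))"
  and tower_step: "tower x \<theta> \<Longrightarrow> descend (x (Suc k)) [\<theta> k] = x k"
  unfolding tower_def by metis+

definition nodes :: "(nat \<Rightarrow> ('v, 'a) node) \<Rightarrow> ('v, 'a) node set" where
  "nodes x = {descend (x k) p |k p. path_from (vertex (x k)) p}"

text \<open>The tiles at which descending paths first leave the range of nonpositive exponents.\<close>

definition leaves :: "(nat \<Rightarrow> ('v, 'a) node) \<Rightarrow> 'a set set" where
  "leaves x = {region (descend z [e]) |z e. z \<in> nodes x \<and> e \<in> out_arcs G (vertex z) \<and>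
     expo z \<le> 0 \<and> expo (descend z [e]) > 0}"

lemma tower_path:
  assumes "tower x \<theta>"
  shows "path_from (vertex (x (m + k))) (rev (map \<theta> [m..<m + k])) \<and>
    descend (x (m + k)) (rev (map \<theta> [m..<m + k])) = x m"
proof (induction k)
  case 0
  then show ?case using tower_proper[OF assms] by (simp add: proper_node_def descend_Nil)
next
  case (Suc k)
  let ?q = "rev (map \<theta> [m..<m + k])"
  note x = tower_step[OF assms, of "m + k"] tower_arc[OF assms, of "m + k"]
  have "vertex (x (m + k)) = head G (\<theta> (m + k))" using arg_cong[OF x(1), of vertex] by simp
  moreover have "descend (x (Suc (m + k))) (\<theta> (m + k) # ?q) = descend (x (m + k)) ?q"
    using descend_append[of "x (Suc (m + k))" "[\<theta> (m + k)]" ?q] x(1) by simp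
  ultimately show ?case using Suc x(2) by simp
qed

lemma tower_node:
  assumes "tower x \<theta>"
  shows "x k \<in> nodes x"
proof -
  have "path_from (vertex (x k)) []" using tower_proper[OF assms] by (simp add: proper_node_def)
  then show ?thesis unfolding nodes_def by (metis (mono_tags, lifting) CollectI descend_Nil)
qed

text \<open>Asking for a nonempty path ensures that the node also has a parent at or below the chosen level.\<close>

lemma nodes_below:
  assumes "tower x \<theta>" "z \<in> nodes x"
  shows "\<exists>K. \<forall>k\<ge>K. \<exists>p. p \<noteq> [] \<and> path_from (vertex (x k)) p \<and> z = descend (x k) p"
proof -
  obtain m p where p: "path_from (vertex (x m)) p" "z = descend (x m) p"
    using assms(2) by (auto simp: nodes_def)
  have "\<exists>p. p \<noteq> [] \<and> path_from (vertex (x k)) p \<and> z = descend (x k) p" if "k \<ge> Suc m" for k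
  proof -
    define j where "j = k - m"
    then have j: "k = m + j" "j > 0" using that by auto
    let ?q = "rev (map \<theta> [m..<m + j])"
    have q: "path_from (vertex (x k)) ?q" "descend (x k) ?q = x m"
      using tower_path[OF assms(1), of m j] j by auto
    have "vertex (x m) = awlast (vertex (x k)) ?q" using arg_cong[OF q(2), of vertex] by simp
    then have "path_from (vertex (x k)) (?q @ p)" using q(1) p(1) by (simp add: path_from_append)
    moreover have "z = descend (x k) (?q @ p)" using p(2) q(2) descend_append by metis
    ultimately show ?thesis using j(2) by (intro exI[of _ "?q @ p"]) auto
  qed
  then show ?thesis by blast
qed

lemma nodes_proper: "tower x \<theta> \<Longrightarrow> z \<in> nodes x \<Longrightarrow> proper_node z"
  by (auto simp: nodes_def intro: proper_descend tower_proper)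

lemma nodes_descend:
  assumes "z \<in> nodes x" "path_from (vertex z) p"
  shows "descend z p \<in> nodes x"
proof -
  obtain k q where "path_from (vertex (x k)) q" "z = descend (x k) q"
    using assms(1) by (auto simp: nodes_def)
  then have "descend z p = descend (x k) (q @ p)" "path_from (vertex (x k)) (q @ p)"
    using assms(2) by (simp_all add: descend_append path_from_append)
  then show ?thesis by (auto simp: nodes_def)
qed

lemma nodes_parent:
  assumes "tower x \<theta>" "z \<in> nodes x"
  shows "\<exists>w e. w \<in> nodes x \<and> e \<in> out_arcs G (vertex w) \<and> z = descend w [e]"
proof -
  obtain k p where p: "p \<noteq> []" "path_from (vertex (x k)) p" "z = descend (x k) p"
    using nodes_below[OF assms] by blast
  obtain q e where q: "p = q @ [e]" using p(1) by (metis rev_exhaust)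
  have "descend (x k) q \<in> nodes x"
    using tower_node[OF assms(1)] p(2) q by (intro nodes_descend) (auto simp: path_from_append)
  moreover have "e \<in> out_arcs G (vertex (descend (x k) q))"
    using p(2) q by (simp add: path_from_append)
  ultimately show ?thesis using p(3) q by (metis descend_append)
qed

lemma nodes_common_ancestor:
  assumes "tower x \<theta>" "z \<in> nodes x" "w \<in> nodes x"
  shows "\<exists>k p q. path_from (vertex (x k)) p \<and> path_from (vertex (x k)) q \<and>
    z = descend (x k) p \<and> w = descend (x k) q"
proof -
  obtain K where K: "\<And>k. k \<ge> K \<Longrightarrow> \<exists>p. path_from (vertex (x k)) p \<and> z = descend (x k) p"
    using nodes_below[OF assms(1,2)] by blast
  obtain L where L: "\<And>k. k \<ge> L \<Longrightarrow> \<exists>p. path_from (vertex (x k)) p \<and> w = descend (x k) p"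
    using nodes_below[OF assms(1,3)] by blast
  show ?thesis using K[of "max K L"] L[of "max K L"] by (meson max.cobounded1 max.cobounded2)
qed

lemma path_deg_prefix: "prefix p q \<Longrightarrow> path_deg d p \<le> path_deg d q"
  by (auto simp: prefix_def)

lemma path_deg_pos: "path_from u p \<Longrightarrow> p \<noteq> [] \<Longrightarrow> path_deg d p > 0"
  using d_pos by (cases p) auto

text \<open>The recognition of supertiles by rigidity. The induction is on the size of the exponent
  because a child has a larger exponent than its parent, and nodes of positive exponent that
  occur as children here are leaves, shared by hypothesis.\<close>

lemma supertiles_determined_by_leaves:
  assumes rigid: "is_rigid G f A s"
    and tow: "tower x \<theta>" and tow': "tower x' \<theta>'" and same: "leaves x = leaves x'"
  shows "z \<in> nodes x \<Longrightarrow> expo z \<le> 0 \<Longrightarrow> \<exists>z'\<in>nodes x'. region z' = region z \<and> expo z' = expo z"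
proof (induction "nat (- expo z)" arbitrary: z rule: less_induct)
  case less
  let ?E = "out_arcs G (vertex z)"
  have pz: "proper_node z" using nodes_proper[OF tow less.prems(1)] .
  then have vz: "vertex z \<in> verts G" by (simp add: proper_node_def)
  \<comment> \<open>Each child of \<open>z\<close> is a region of the second hierarchy and has a parent \<open>w\<close> there.\<close>
  have "\<exists>w a. w \<in> nodes x' \<and> a \<in> out_arcs G (vertex w) \<and>
      region (descend w [a]) = region (descend z [e])" if e: "e \<in> ?E" for e
  proof (cases "expo (descend z [e]) \<le> 0")
    case True
    have "d e > 0" using e d_pos by auto
    have "descend z [e] \<in> nodes x" using less.prems(1) e by (intro nodes_descend) auto
    then obtain y where "y \<in> nodes x'" "region y = region (descend z [e])"
      using less.hyps[of "descend z [e]"] True \<open>d e > 0\<close> by auto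
    then show ?thesis using nodes_parent[OF tow'] by metis
  next
    case False
    then have "expo (descend z [e]) > 0" by simp
    then have "region (descend z [e]) \<in> leaves x"
      using less.prems e unfolding leaves_def by blast
    then have "region (descend z [e]) \<in> leaves x'" using same by simp
    then obtain w a where "w \<in> nodes x'" "a \<in> out_arcs G (vertex w)"
      "region (descend z [e]) = region (descend w [a])"
      unfolding leaves_def by blast
    then show ?thesis by metis
  qed
  then obtain w a where w: "\<And>e. e \<in> ?E \<Longrightarrow> w e \<in> nodes x'"
    and a: "\<And>e. e \<in> ?E \<Longrightarrow> a e \<in> out_arcs G (vertex (w e))"
    and wa: "\<And>e. e \<in> ?E \<Longrightarrow> region (descend (w e) [a e]) = region (descend z [e])"
    by metis
  \<comment> \<open>The parent of smallest scale is the one whose subdivision is compared with that of \<open>z\<close>.\<close>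
  have fin: "finite ((\<lambda>e. expo (w e)) ` ?E)" by (simp add: finite_out_arcs)
  then have "Max ((\<lambda>e. expo (w e)) ` ?E) \<in> (\<lambda>e. expo (w e)) ` ?E"
    using out_arcs_nonempty[OF vz] by (intro Max_in) auto
  then obtain e0 where e0: "e0 \<in> ?E" and "Max ((\<lambda>e. expo (w e)) ` ?E) = expo (w e0)" by auto
  then have max: "expo (w e) \<le> expo (w e0)" if "e \<in> ?E" for e
    using fin that by (metis Max_ge image_eqI)
  let ?p = "w e0"
  have pp: "proper_node ?p" using nodes_proper[OF tow' w[OF e0]] .
  have common: "region (descend z [e0]) \<in> children ?p"
    unfolding children_def wa[OF e0, symmetric] using a[OF e0] by blast
  have cross: "t = t' \<or> interior (t \<inter> t') = {}" if t: "t \<in> children z" "t' \<in> children ?p" for t t'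
  proof -
    obtain e where e: "e \<in> ?E" "t = region (descend z [e])" using t(1) by (auto simp: children_def)
    obtain b where b: "b \<in> out_arcs G (vertex ?p)" "t' = region (descend ?p [b])"
      using t(2) by (auto simp: children_def)
    obtain k u v where uv: "path_from (vertex (x' k)) u" "path_from (vertex (x' k)) v"
      "w e = descend (x' k) u" "?p = descend (x' k) v"
      using nodes_common_ancestor[OF tow' w[OF e(1)] w[OF e0]] by blast
    have tt: "t = region (descend (x' k) (u @ [a e]))" "t' = region (descend (x' k) (v @ [b]))"
      using wa[OF e(1)] e(2) b(2) uv(3,4) by (metis descend_append)+
    have paths: "path_from (vertex (x' k)) (u @ [a e])" "path_from (vertex (x' k)) (v @ [b])"
      using uv a[OF e(1)] b(1) awlast_verts by (auto simp: path_from_append)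
    have px: "proper_node (x' k)" using tower_proper[OF tow'] .
    consider "u @ [a e] = v @ [b]" | "prefix (u @ [a e]) v" | "prefix (v @ [b]) u"
      | "interior (t \<inter> t') = {}"
      using descend_cases[OF px paths] unfolding tt prefix_snoc by blast
    then show ?thesis
    proof cases
      case 1
      then show ?thesis using tt by simp
    next
      \<comment> \<open>Here \<open>t\<close> contains the whole region of \<open>?p\<close>, hence also the shared child \<open>e0\<close>; siblings
        do not overlap, so \<open>t\<close> is that child.\<close>
      case 2
      then obtain r where r: "v = (u @ [a e]) @ r" by (auto simp: prefix_def)
      have "region (descend z [e0]) \<subseteq> region ?p"
        using common Union_children[of ?p] pp by (auto simp: proper_node_def)
      also have "\<dots> \<subseteq> t"
        using region_descend_antimono[of "x' k" "u @ [a e]" r] uv(2,4) r tt(1) by simp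
      finally have sub: "region (descend z [e0]) \<subseteq> t" .
      have "e = e0"
      proof (rule ccontr)
        assume "e \<noteq> e0"
        then have "interior (region (descend z [e0])) = {}"
          using siblings_nonoverlap[OF pz e(1) e0] sub e(2) by (simp add: Int_absorb1)
        then show False
          using interior_region[OF proper_descend[OF pz, of "[e0]"]] e0 by simp
      qed
      then have "t = region (descend ?p [a e0])" using wa[OF e0] e(2) by simp
      then show ?thesis using siblings_nonoverlap[OF pp a[OF e0] b(1)] b(2) by auto
    next
      \<comment> \<open>Here \<open>t\<close> would lie strictly inside \<open>t'\<close>, so its parent would be smaller than \<open>?p\<close>.\<close>
      case 3
      then have "path_deg d v + d b \<le> path_deg d u" using path_deg_prefix by fastforce
      moreover have "d b > 0" using b(1) d_pos by auto
      ultimately have "expo (w e) > expo ?p"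
        unfolding uv(4) using arg_cong[OF uv(3), of expo] by simp
      then show ?thesis using max[OF e(1)] by simp
    qed simp
  qed
  have tiles: "is_tile t" if "t \<in> children z \<union> children ?p" for t
    using that is_tile_children pz pp by blast
  have "tiles_region (children z \<inter> children ?p) (\<Union>(children z) \<inter> \<Union>(children ?p))"
  proof (rule tiles_region_common_tiles)
    show "interior (t \<inter> t') = {}" if "t \<in> children z" "t' \<in> children z" "t \<noteq> t'" for t t'
      using that siblings_nonoverlap[OF pz] unfolding children_def by blast
  qed (use cross tiles finite_children in auto)
  moreover have "region (descend z [e0]) \<in> children z" using e0 unfolding children_def by blast
  then have "children z \<inter> children ?p \<noteq> {}" using common by blast
  ultimately have "vertex z = vertex ?p" "children z = children ?p"
    using rigid basic_subdivision_children[OF pz] basic_subdivision_children[OF pp] pp vz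
    unfolding is_rigid_def proper_node_def by blast+
  then have "region z = region ?p" using Union_children vz by metis
  then show ?case
    using expo_eq_of_region_eq[OF pz pp] \<open>vertex z = vertex ?p\<close> w[OF e0] by auto
qed

section \<open>Towers with the same leaves merge\<close>

lemma (in -) strictly_decreasing_eq_of_range_eq:
  fixes a b :: "nat \<Rightarrow> int"
  assumes a: "\<And>k l. k < l \<Longrightarrow> a l < a k" and b: "\<And>k l. k < l \<Longrightarrow> b l < b k"
    and eq: "range a = range b"
  shows "a k = b k"
proof (induction k rule: less_induct)
  case (less k)
  obtain l where l: "b k = a l" using eq by (metis rangeE rangeI)
  have "\<not> l < k" using less b[of l k] l by auto
  then have "a l \<le> a k" using a[of k l] by (cases "k = l") auto
  obtain l' where l': "a k = b l'" using eq by (metis rangeE rangeI)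
  have "\<not> l' < k" using less a[of l' k] l' by auto
  then have "b l' \<le> b k" using b[of k l'] by (cases "k = l'") auto
  then show ?case using \<open>a l \<le> a k\<close> l l' by simp
qed

lemma tower_expo_decreasing:
  assumes "tower x \<theta>" "k < l"
  shows "expo (x l) < expo (x k)"
  using assms(2)
proof (rule less_Suc_induct)
  fix i
  have "d (\<theta> i) > 0" using tower_arc[OF assms(1), of i] d_pos by simp
  then show "expo (x (Suc i)) < expo (x i)"
    using arg_cong[OF tower_step[OF assms(1), of i], of expo] by simp
qed simp

lemma region_descend_subset: "path_from (vertex z) p \<Longrightarrow> region (descend z p) \<subseteq> region z"
  using region_descend_antimono[of z "[]" p] by (simp add: descend_Nil)

lemma tower_region_mono:
  assumes "tower x \<theta>" "k \<le> l"
  shows "region (x k) \<subseteq> region (x l)"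
proof -
  obtain j where "l = k + j" using assms(2) le_Suc_ex by blast
  then show ?thesis using tower_path[OF assms(1), of k j] region_descend_subset by metis
qed

text \<open>The members of the tower from level \<open>m\<close> on are characterised by region and exponent alone,
  without reference to the tree structure; this lets the tower be found again in another
  hierarchy with the same supertiles.\<close>

lemma ancestors_in_tower:
  assumes tow: "tower x \<theta>" and z: "z \<in> nodes x"
    and sub: "region (x m) \<subseteq> region z" and le: "expo z \<le> expo (x m)"
  shows "\<exists>k\<ge>m. z = x k"
proof -
  obtain K where K: "\<And>k. k \<ge> K \<Longrightarrow> \<exists>p. path_from (vertex (x k)) p \<and> z = descend (x k) p"
    using nodes_below[OF tow z] by blast
  define k where "k = m + K"
  then obtain p where p: "path_from (vertex (x k)) p" "z = descend (x k) p" using K[of k] by auto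
  define q where "q = rev (map \<theta> [m..<k])"
  have q: "path_from (vertex (x k)) q" "descend (x k) q = x m"
    using tower_path[OF tow, of m K] by (simp_all add: q_def k_def)
  have "interior (region z \<inter> region (x m)) \<noteq> {}"
    using sub interior_region[OF tower_proper[OF tow], of m] by (simp add: Int_absorb1)
  then have "prefix p q \<or> prefix q p"
    using descend_cases[OF tower_proper[OF tow] p(1) q(1)] p(2) q(2) by auto
  then have "prefix p q"
  proof
    assume "prefix q p"
    then obtain r where r: "p = q @ r" by (auto simp: prefix_def)
    have "expo z = expo (x m) + int (path_deg d r)"
      using p(2) r arg_cong[OF q(2), of expo] by simp
    then have "path_deg d r = 0" using le by simp
    then have "r = []" using path_deg_pos p(1) r path_from_append by fastforce
    then show "prefix p q" using r by simp
  qed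
  define l where "l = k - length p"
  have "length p \<le> length q" using \<open>prefix p q\<close> by (rule prefix_length_le)
  then have l: "k = l + length p" "m \<le> l" by (auto simp: l_def q_def k_def)
  have "p = take (length p) q" using \<open>prefix p q\<close> by (auto simp: prefix_def)
  also have "\<dots> = rev (map \<theta> [l..<k])"
    using l by (simp add: q_def take_rev drop_map)
  finally have "z = x l" using tower_path[OF tow, of l "length p"] p(2) l(1) by simp
  then show ?thesis using l(2) by blast
qed

definition supertiles :: "(nat \<Rightarrow> ('v, 'a) node) \<Rightarrow> ('a set \<times> int) set" where
  "supertiles x = {(region z, expo z) |z. z \<in> nodes x \<and> expo z \<le> 0}"

lemma node_in_supertiles: "z \<in> nodes x \<Longrightarrow> expo z \<le> 0 \<Longrightarrow> (region z, expo z) \<in> supertiles x"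
  unfolding supertiles_def by blast

lemma supertiles_node: "(P, b) \<in> supertiles x \<Longrightarrow> \<exists>z\<in>nodes x. region z = P \<and> expo z = b"
  unfolding supertiles_def by blast

lemma supertiles_above:
  assumes tow: "tower x \<theta>" and "expo (x 0) \<le> 0"
  shows "{(P, b) \<in> supertiles x. region (x m) \<subseteq> P \<and> b \<le> expo (x m)}
    = range (\<lambda>r. (region (x (m + r)), expo (x (m + r))))"
proof (intro equalityI subsetI)
  fix y assume "y \<in> {(P, b) \<in> supertiles x. region (x m) \<subseteq> P \<and> b \<le> expo (x m)}"
  then obtain z where z: "z \<in> nodes x" "region (x m) \<subseteq> region z" "expo z \<le> expo (x m)"
    "y = (region z, expo z)"
    unfolding supertiles_def by blast
  then obtain k where "k \<ge> m" "z = x k" using ancestors_in_tower[OF tow] by blast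
  then show "y \<in> range (\<lambda>r. (region (x (m + r)), expo (x (m + r))))"
    using z(4) le_Suc_ex by blast
next
  fix y assume "y \<in> range (\<lambda>r. (region (x (m + r)), expo (x (m + r))))"
  then obtain r where r: "y = (region (x (m + r)), expo (x (m + r)))" by blast
  have dec: "expo (x l) \<le> expo (x k)" if "k \<le> l" for k l
    using that tower_expo_decreasing[OF tow, of k l] by (cases "k = l") auto
  have "expo (x (m + r)) \<le> 0" using dec[of 0 "m + r"] assms(2) by simp
  then have "y \<in> supertiles x" unfolding r by (intro node_in_supertiles tower_node[OF tow])
  then show "y \<in> {(P, b) \<in> supertiles x. region (x m) \<subseteq> P \<and> b \<le> expo (x m)}"
    using r dec[of m "m + r"] tower_region_mono[OF tow, of m "m + r"] by simp
qed

lemma supertiles_subset_of_leaves_eq: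
  assumes "is_rigid G f A s" "tower x \<theta>" "tower x' \<theta>'" "leaves x = leaves x'"
  shows "supertiles x \<subseteq> supertiles x'"
proof
  fix y assume "y \<in> supertiles x"
  then obtain z where z: "z \<in> nodes x" "expo z \<le> 0" "y = (region z, expo z)"
    unfolding supertiles_def by blast
  then obtain z' where "z' \<in> nodes x'" "region z' = region z" "expo z' = expo z"
    using supertiles_determined_by_leaves[OF assms] by blast
  then show "y \<in> supertiles x'" using z unfolding supertiles_def by (intro CollectI exI[of _ z']) simp
qed

text \<open>The base of the second tower is a supertile of the first hierarchy, so some member of the
  first tower contains it and thereby belongs to both towers. From there on, both towers consist of
  the same supertiles, and the exponents fix their order.\<close>

lemma towers_with_same_leaves_merge:
  assumes rigid: "is_rigid G f A s"
    and tow: "tower x \<theta>" and tow': "tower x' \<theta>'" and same: "leaves x = leaves x'"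
    and x0: "expo (x 0) \<le> 0" "expo (x' 0) \<le> 0"
  shows "\<exists>m m'. \<forall>r. region (x (m + r)) = region (x' (m' + r))"
proof -
  have eq: "supertiles x = supertiles x'"
    using supertiles_subset_of_leaves_eq[OF rigid tow tow' same]
      supertiles_subset_of_leaves_eq[OF rigid tow' tow same[symmetric]] by (rule equalityI)
  have "(region (x' 0), expo (x' 0)) \<in> supertiles x"
    unfolding eq using tower_node[OF tow'] x0(2) by (rule node_in_supertiles)
  then obtain z where z: "z \<in> nodes x" "region z = region (x' 0)" "expo z = expo (x' 0)"
    using supertiles_node by blast
  obtain m p where p: "path_from (vertex (x m)) p" "z = descend (x m) p"
    using nodes_below[OF tow z(1)] by blast
  have "(region (x m), expo (x m)) \<in> range (\<lambda>r. (region (x (m + r)), expo (x (m + r))))"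
    by (rule range_eqI[of _ _ 0]) simp
  then have "(region (x m), expo (x m)) \<in> supertiles x'"
    using supertiles_above[OF tow x0(1), of m] eq by blast
  moreover have "region (x' 0) \<subseteq> region (x m)" using region_descend_subset[OF p(1)] p(2) z(2) by simp
  moreover have "expo (x m) \<le> expo (x' 0)" using arg_cong[OF p(2), of expo] z(3) by simp
  ultimately have "(region (x m), expo (x m)) \<in> range (\<lambda>r. (region (x' (0 + r)), expo (x' (0 + r))))"
    unfolding supertiles_above[OF tow' x0(2), of 0, symmetric] by simp
  then obtain m' where m': "region (x m) = region (x' m')" "expo (x m) = expo (x' m')" by auto
  let ?F = "\<lambda>r. (region (x (m + r)), expo (x (m + r)))"
  let ?F' = "\<lambda>r. (region (x' (m' + r)), expo (x' (m' + r)))"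
  have ran: "range ?F = range ?F'"
    using supertiles_above[OF tow x0(1), of m] supertiles_above[OF tow' x0(2), of m'] eq m' by simp
  have "range (\<lambda>r. expo (x (m + r))) = snd ` range ?F" "range (\<lambda>r. expo (x' (m' + r))) = snd ` range ?F'"
    by (simp_all add: image_image)
  then have "range (\<lambda>r. expo (x (m + r))) = range (\<lambda>r. expo (x' (m' + r)))"
    using ran by simp
  then have expos: "expo (x (m + r)) = expo (x' (m' + r))" for r
    using strictly_decreasing_eq_of_range_eq[of "\<lambda>r. expo (x (m + r))" "\<lambda>r. expo (x' (m' + r))" r]
      tower_expo_decreasing[OF tow] tower_expo_decreasing[OF tow'] by simp
  have "region (x (m + r)) = region (x' (m' + r))" for r
  proof -
    have "?F r \<in> range ?F'" using ran by blast
    then obtain r' where r': "?F r = ?F' r'" by blast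
    then have "expo (x' (m' + r)) = expo (x' (m' + r'))" using expos[of r] by simp
    then have "r = r'"
      using tower_expo_decreasing[OF tow', of "m' + r" "m' + r'"]
        tower_expo_decreasing[OF tow', of "m' + r'" "m' + r"] by (cases r r' rule: linorder_cases) auto
    then show ?thesis using r' by simp
  qed
  then show ?thesis by blast
qed

section \<open>The tower of a parameter\<close>

lemma parameter_arc:
  assumes "is_parameter G \<theta>"
  shows "\<theta> k \<in> out_arcs G (param_vertex G \<theta> (Suc k))"
    and "head G (\<theta> k) = param_vertex G \<theta> k"
proof -
  have \<theta>: "\<theta> j \<in> arcs G" "tail G (\<theta> j) = head G (\<theta> (Suc j))" for j
    using assms by (auto simp: is_parameter_def is_inf_path_def reverse_digraph_def)
  show "\<theta> k \<in> out_arcs G (param_vertex G \<theta> (Suc k))"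
    using \<theta> by (simp add: param_vertex_def reverse_digraph_def)
  show "head G (\<theta> k) = param_vertex G \<theta> k"
    using \<theta>(2) by (cases k) (auto simp: param_vertex_def reverse_digraph_def)
qed

definition supertile_map :: "(nat \<Rightarrow> 'e) \<Rightarrow> nat \<Rightarrow> 'a \<Rightarrow> 'a" where
  "supertile_map \<theta> k = comp_list (\<lambda>e. inv (f e)) (param_take \<theta> k)"

definition supertile :: "(nat \<Rightarrow> 'e) \<Rightarrow> nat \<Rightarrow> 'a set" where
  "supertile \<theta> k = supertile_map \<theta> k ` A (param_vertex G \<theta> k)"

definition param_tower :: "('a \<Rightarrow> 'a) \<Rightarrow> (nat \<Rightarrow> 'e) \<Rightarrow> nat \<Rightarrow> ('v, 'a) node" where
  "param_tower U \<theta> k =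
    (U \<circ> supertile_map \<theta> k, param_vertex G \<theta> k, - int (path_deg d (param_take \<theta> k)))"

lemma param_take_Suc: "param_take \<theta> (Suc k) = param_take \<theta> k @ [\<theta> k]"
  by (simp add: param_take_def)

lemma supertile_map_0: "supertile_map \<theta> 0 = id"
  by (simp add: supertile_map_def param_take_def)

lemma supertile_map_Suc: "supertile_map \<theta> (Suc k) = supertile_map \<theta> k \<circ> inv (f (\<theta> k))"
  by (simp add: supertile_map_def param_take_Suc comp_list_append)

lemma supertile_map_step:
  assumes "is_parameter G \<theta>"
  shows "supertile_map \<theta> (Suc k) \<circ> f (\<theta> k) = supertile_map \<theta> k"
proof -
  have "bij (f (\<theta> k))" using parameter_arc(1)[OF assms, of k] bij_f by simp
  then have "inv (f (\<theta> k)) \<circ> f (\<theta> k) = id" by (simp add: bij_is_inj)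
  then show ?thesis by (simp add: supertile_map_Suc comp_assoc)
qed

lemma supertile_map_similarity:
  assumes "is_parameter G \<theta>"
  shows "similarity_map (s powi (- int (path_deg d (param_take \<theta> k)))) (supertile_map \<theta> k)"
    and "bij (supertile_map \<theta> k)"
proof (induction k)
  case 0
  case 1
  show ?case by (simp add: supertile_map_0 similarity_map_def param_take_def)
  case 2
  show ?case unfolding supertile_map_0 by (rule bij_id)
next
  case (Suc k)
  have e: "\<theta> k \<in> arcs G" using parameter_arc(1)[OF assms, of k] by simp
  have "s powi (- int (path_deg d (param_take \<theta> k))) * (1 / s ^ d (\<theta> k)) =
      s powi (- int (path_deg d (param_take \<theta> (Suc k))))"
    using s_pos by (simp add: param_take_Suc power_int_minus power_int_diff divide_inverse mult.commute)
  moreover have "similarity_map (1 / s ^ d (\<theta> k)) (inv (f (\<theta> k)))"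
    using similarity_inv[OF sim_f[OF e] bij_f[OF e]] s_pos by simp
  note similarity_comp[OF Suc(1) this]
  ultimately show "similarity_map (s powi (- int (path_deg d (param_take \<theta> (Suc k))))) (supertile_map \<theta> (Suc k))"
    unfolding supertile_map_Suc by simp
  show "bij (supertile_map \<theta> (Suc k))"
    unfolding supertile_map_Suc using Suc(2) bij_f[OF e] by (intro bij_comp bij_imp_bij_inv)
qed

lemma tower_param_tower:
  assumes "isometry_map U" "is_parameter G \<theta>"
  shows "tower (param_tower U \<theta>) \<theta>"
  unfolding tower_def
proof (intro allI conjI)
  fix k
  have "similarity_map 1 U" using assms(1) by (simp add: isometry_map_def similarity_map_def)
  from similarity_comp[OF this supertile_map_similarity(1)[OF assms(2), of k]]
  show "proper_node (param_tower U \<theta> k)"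
    using bij_comp[OF supertile_map_similarity(2)[OF assms(2), of k] isometry_map_bij[OF assms(1)]]
      parameter_arc[OF assms(2), of k] head_in_verts[of "\<theta> k"]
    by (simp add: proper_node_def param_tower_def)
  show "\<theta> k \<in> out_arcs G (vertex (param_tower U \<theta> (Suc k)))"
    using parameter_arc(1)[OF assms(2)] unfolding param_tower_def fst_conv snd_conv .
  show "param_tower U \<theta> k = descend (param_tower U \<theta> (Suc k)) [\<theta> k]"
    using supertile_map_step[OF assms(2), of k] parameter_arc(2)[OF assms(2), of k]
    by (simp add: param_tower_def descend_def comp_assoc param_take_Suc)
qed

lemma region_param_tower: "region (param_tower U \<theta> k) = U ` supertile \<theta> k"
  by (simp add: region_def param_tower_def supertile_def image_comp)

text \<open>The inequalities that define the balanced sequence say that the exponent of a tile is positive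
  and that of its parent is not.\<close>

lemma leaves_param_tower:
  "leaves (param_tower U \<theta>) = (\<lambda>t. U ` t) ` balanced_tiling G f A d \<theta>"
proof -
  let ?x = "param_tower U \<theta>"
  let ?D = "\<lambda>k. int (path_deg d (param_take \<theta> k))"
  have reg: "region (descend (?x k) p) = U ` ((supertile_map \<theta> k \<circ> comp_list f p) ` A (awlast (param_vertex G \<theta> k) p))"
    for k p by (simp add: region_descend piece_def param_tower_def image_comp)
  have "t \<in> leaves ?x \<longleftrightarrow> (\<exists>k p e. path_from (param_vertex G \<theta> k) (p @ [e]) \<and>
      int (path_deg d p) \<le> ?D k \<and> ?D k < int (path_deg d (p @ [e])) \<and>
      t = region (descend (?x k) (p @ [e])))" (is "_ \<longleftrightarrow> ?R") for t
  proof
    assume "t \<in> leaves ?x"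
    then obtain z e where z: "t = region (descend z [e])" "z \<in> nodes ?x" "e \<in> out_arcs G (vertex z)"
      "expo z \<le> 0" "expo (descend z [e]) > 0"
      unfolding leaves_def by blast
    obtain k p where p: "path_from (vertex (?x k)) p" "z = descend (?x k) p"
      using z(2) unfolding nodes_def by blast
    have "path_from (param_vertex G \<theta> k) (p @ [e])"
      using p z(3) awlast_verts unfolding path_from_append by (simp add: param_tower_def)
    moreover have "int (path_deg d p) \<le> ?D k" "?D k < int (path_deg d (p @ [e]))"
      using z(4,5) p(2) by (simp_all add: param_tower_def)
    moreover have "t = region (descend (?x k) (p @ [e]))"
      using z(1) p(2) descend_append by simp
    ultimately show ?R by blast
  next
    assume ?R
    then obtain k p e where kpe: "path_from (param_vertex G \<theta> k) (p @ [e])"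
      "int (path_deg d p) \<le> ?D k" "?D k < int (path_deg d (p @ [e]))"
      "t = region (descend (?x k) (p @ [e]))" by blast
    let ?z = "descend (?x k) p"
    have v: "vertex (?x k) = param_vertex G \<theta> k" by (simp add: param_tower_def)
    have "?z \<in> nodes ?x" using kpe(1) unfolding nodes_def v[symmetric] path_from_append by blast
    moreover have "e \<in> out_arcs G (vertex ?z)" using kpe(1) v by (simp add: path_from_append)
    moreover have "expo ?z \<le> 0" "expo (descend ?z [e]) > 0"
      using kpe(2,3) by (simp_all add: param_tower_def)
    moreover have "t = region (descend ?z [e])" using kpe(4) descend_append by simp
    ultimately show "t \<in> leaves ?x" unfolding leaves_def by blast
  qed
  moreover have "t \<in> (\<lambda>t. U ` t) ` balanced_tiling G f A d \<theta> \<longleftrightarrow>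
     (\<exists>k q. q \<noteq> [] \<and> path_from (param_vertex G \<theta> k) q \<and> ?D k < int (path_deg d q) \<and>
       int (path_deg d q) - ?D k \<le> int (d (last q)) \<and> t = region (descend (?x k) q))" for t
  proof -
    have "(\<lambda>t. U ` t) ` balanced_tiling G f A d \<theta>
        = (\<Union>k. (\<lambda>\<sigma>. region (descend (?x k) (snd \<sigma>))) ` balanced_sequence G d \<theta> k)"
      unfolding balanced_tiling_def all_tiles_def level_tiles_def image_UN image_image reg
        supertile_map_def[symmetric]
      by (intro SUP_cong image_cong refl) (simp add: balanced_sequence_def path_end_def)
    moreover have "balanced_sequence G d \<theta> k = Pair (param_vertex G \<theta> k) `
        {q. q \<noteq> [] \<and> path_from (param_vertex G \<theta> k) q \<and> ?D k < int (path_deg d q) \<and>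
          int (path_deg d q) - ?D k \<le> int (d (last q))}" for k
      unfolding balanced_sequence_def using fin_paths_iff by auto
    ultimately have "(\<lambda>t. U ` t) ` balanced_tiling G f A d \<theta> = (\<Union>k. (\<lambda>q. region (descend (?x k) q)) `
        {q. q \<noteq> [] \<and> path_from (param_vertex G \<theta> k) q \<and> ?D k < int (path_deg d q) \<and>
          int (path_deg d q) - ?D k \<le> int (d (last q))})"
      by (simp only: image_image snd_conv)
    moreover have "t \<in> (\<Union>k. g k ` {q. P k q}) \<longleftrightarrow> (\<exists>k q. P k q \<and> t = g k q)"
      for g :: "nat \<Rightarrow> 'e list \<Rightarrow> 'a set" and P by blast
    ultimately show ?thesis by (simp only: conj_assoc)
  qed
  moreover have "(\<exists>q. q \<noteq> [] \<and> P q) \<longleftrightarrow> (\<exists>p e. P (p @ [e]))" for P :: "'e list \<Rightarrow> bool"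
    by (metis append_is_Nil_conv not_Cons_self2 rev_exhaust)
  moreover have "int (path_deg d (p @ [e])) - D \<le> int (d (last (p @ [e]))) \<longleftrightarrow> int (path_deg d p) \<le> D"
    for p e D by simp
  ultimately show ?thesis by (intro set_eqI) (simp only: conj_ac)
qed

lemma congruent_balanced_tilings_merge:
  assumes "is_rigid G f A s" "is_parameter G \<theta>" "is_parameter G \<theta>'"
    and "congruent_sets (balanced_tiling G f A d \<theta>) (balanced_tiling G f A d \<theta>')"
  shows "\<exists>U m m'. isometry_map U \<and> (\<forall>r. U ` supertile \<theta> (m + r) = supertile \<theta>' (m' + r))"
proof -
  obtain U where U: "isometry_map U"
    "balanced_tiling G f A d \<theta>' = (\<lambda>t. U ` t) ` balanced_tiling G f A d \<theta>"
    using assms(4) by (auto simp: congruent_sets_def)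
  have id: "isometry_map id" by (simp add: isometry_map_def)
  have "leaves (param_tower U \<theta>) = leaves (param_tower id \<theta>')"
    using U(2) by (simp add: leaves_param_tower)
  then obtain m m' where "\<forall>r. region (param_tower U \<theta> (m + r)) = region (param_tower id \<theta>' (m' + r))"
    using towers_with_same_leaves_merge[OF assms(1) tower_param_tower[OF U(1) assms(2)]
        tower_param_tower[OF id assms(3)]] by (auto simp: param_tower_def)
  then show ?thesis using U(1) by (auto simp: region_param_tower)
qed

lemma supertile_mono:
  assumes "is_parameter G \<theta>" "k \<le> l"
  shows "supertile \<theta> k \<subseteq> supertile \<theta> l"
  using tower_region_mono[OF tower_param_tower[of id \<theta>] assms(2)] assms(1)
  by (simp add: region_param_tower isometry_map_def)

text \<open>Follow the address of \<open>x\<close> through the pre-tree. A longest path of the address that is still a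
  subpath of a member is itself a member, since below a proper subpath the pre-tree offers every
  edge.\<close>

lemma pretree_covers:
  assumes S: "is_pretree G r S" and x: "x \<in> A r"
  shows "\<exists>\<sigma>\<in>S. x \<in> comp_list f (snd \<sigma>) ` A (path_end G \<sigma>)"
proof -
  let ?Q = "\<lambda>p. (\<exists>\<rho>\<in>S. is_subpath (r, p) \<rho>) \<and> x \<in> piece r p"
  have fin: "finite S" and paths: "S \<subseteq> fin_paths G" and root: "\<And>\<sigma>. \<sigma> \<in> S \<Longrightarrow> fst \<sigma> = r"
    using S by (auto simp: is_pretree_def)
  obtain \<sigma>0 where "\<sigma>0 \<in> S" using S by (auto simp: is_pretree_def)
  moreover have "is_subpath (r, []) \<sigma>0" using root[OF \<open>\<sigma>0 \<in> S\<close>] by (simp add: is_subpath_def)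
  ultimately have Q0: "?Q []" using x piece_Nil by blast
  have bound: "length p < Suc (Max (length ` snd ` S))" if Q: "?Q p" for p
  proof -
    obtain \<rho> where \<rho>: "\<rho> \<in> S" "is_subpath (r, p) \<rho>" using Q by blast
    then have "length p \<le> length (snd \<rho>)" by (simp add: is_subpath_def prefix_length_le)
    also have "\<dots> \<le> Max (length ` snd ` S)" using fin \<rho>(1) by (intro Max_ge) auto
    finally show ?thesis by simp
  qed
  obtain p where p: "?Q p" and max: "\<And>q. ?Q q \<Longrightarrow> length q \<le> length p"
    using ex_has_greatest_nat[of ?Q "[]" length "Suc (Max (length ` snd ` S))"] Q0 bound by (metis less_imp_le)
  obtain \<rho> where \<rho>: "\<rho> \<in> S" "is_subpath (r, p) \<rho>" using p by blast
  have "(r, p) \<in> S"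
  proof (rule ccontr)
    assume "(r, p) \<notin> S"
    then have proper: "is_proper_subpath (r, p) \<rho>"
      using \<rho> root by (cases \<rho>) (auto simp: is_subpath_def is_proper_subpath_def strict_prefix_def)
    have "path_from r (snd \<rho>)" using paths \<rho>(1) root fin_paths_iff by (metis prod.collapse subsetD)
    then have "path_from r p" using \<rho>(2) by (auto simp: is_subpath_def prefix_def path_from_append)
    then have v: "awlast r p \<in> verts G" by (rule awlast_verts)
    obtain y where y: "y \<in> A (awlast r p)" "x = comp_list f p y" using p by (auto simp: piece_def)
    then obtain e where e: "e \<in> out_arcs G (awlast r p)" "y \<in> piece (awlast r p) [e]"
      unfolding attractor_eq[OF v] by auto
    then have xe: "x \<in> piece r (p @ [e])" using y(2) by (simp add: piece_append)
    have "\<exists>\<rho>'\<in>S. is_subpath (r, p @ [e]) \<rho>'"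
      using e(1) S \<rho>(1) proper unfolding is_pretree_def path_end_def by (metis fst_conv snd_conv)
    then show False using max[of "p @ [e]"] xe by auto
  qed
  then show ?thesis using p by (intro bexI[of _ "(r, p)"]) (auto simp: path_end_def piece_def)
qed

text \<open>By the covering property of pre-trees, the level-\<open>k\<close> tiles of any sequence cover the main
  supertile of level \<open>k\<close>.\<close>

lemma filling_if_supertiles_exhaust:
  assumes "is_parameter G \<theta>" "(\<Union>k. supertile \<theta> k) = UNIV"
  shows "is_filling G f A \<theta>"
  unfolding is_filling_def
proof (intro conjI allI impI)
  fix S assume S: "is_param_sequence G \<theta> S"
  have "supertile \<theta> k \<subseteq> \<Union>(all_tiles G f A \<theta> S)" for k
  proof
    fix y assume "y \<in> supertile \<theta> k"
    then obtain x where x: "x \<in> A (param_vertex G \<theta> k)" "y = supertile_map \<theta> k x"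
      by (auto simp: supertile_def)
    have "is_pretree G (param_vertex G \<theta> k) (S k)" using S by (simp add: is_param_sequence_def)
    then obtain \<sigma> where "\<sigma> \<in> S k" "x \<in> comp_list f (snd \<sigma>) ` A (path_end G \<sigma>)"
      using pretree_covers x(1) by blast
    then have "y \<in> (supertile_map \<theta> k \<circ> comp_list f (snd \<sigma>)) ` A (path_end G \<sigma>)"
      using x(2) by auto
    then show "y \<in> \<Union>(all_tiles G f A \<theta> S)"
      using \<open>\<sigma> \<in> S k\<close> unfolding all_tiles_def level_tiles_def supertile_map_def by blast
  qed
  then show "\<Union>(all_tiles G f A \<theta> S) = UNIV" using assms(2) by blast
qed (rule assms(1))

section \<open>Loops and frontier addresses\<close>

lemma point_address:
  assumes "i \<in> verts G" "x \<in> A i"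
  shows "\<exists>p. path_from i p \<and> length p = m \<and> x \<in> piece i p"
proof (induction m)
  case 0
  then show ?case using assms by (intro exI[of _ "[]"]) simp
next
  case (Suc m)
  then obtain p where p: "path_from i p" "length p = m" "x \<in> piece i p" by blast
  then obtain y where y: "y \<in> A (awlast i p)" "x = comp_list f p y" by (auto simp: piece_def)
  then obtain e where "e \<in> out_arcs G (awlast i p)" "y \<in> piece (awlast i p) [e]"
    unfolding attractor_eq[OF awlast_verts[OF p(1)]] by auto
  then have "path_from i (p @ [e])" "length (p @ [e]) = Suc m" "x \<in> piece i (p @ [e])"
    using p(1,2) y(2) by (auto simp: path_from_append piece_append)
  then show ?case by blast
qed

lemma length_le_path_deg: "path_from u p \<Longrightarrow> length p \<le> path_deg d p"
proof (induction p arbitrary: u)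
  case (Cons e p)
  then have "d e > 0" "length p \<le> path_deg d p" using d_pos by auto
  then show ?case by simp
qed simp

lemma pieces_shrink:
  assumes "\<epsilon> > 0"
  shows "\<exists>m. \<forall>i p x y. path_from i p \<longrightarrow> length p = m \<longrightarrow> x \<in> piece i p \<longrightarrow> y \<in> piece i p \<longrightarrow> dist x y < \<epsilon>"
proof -
  have "bounded (\<Union>i\<in>verts G. A i)" using compact_A compact_imp_bounded by (intro bounded_UN) auto
  then obtain D where D: "\<And>u v i j. i \<in> verts G \<Longrightarrow> j \<in> verts G \<Longrightarrow> u \<in> A i \<Longrightarrow> v \<in> A j \<Longrightarrow> dist u v \<le> D"
    unfolding bounded_two_points by blast
  define D' where "D' = max D 1"
  obtain m where m: "s ^ m < \<epsilon> / D'"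
    using real_arch_pow_inv[of "\<epsilon> / D'" s] assms s_less_1 by (auto simp: D'_def)
  have "dist x y < \<epsilon>" if p: "path_from i p" "length p = m" and xy: "x \<in> piece i p" "y \<in> piece i p" for i p x y
  proof -
    obtain u v where uv: "u \<in> A (awlast i p)" "v \<in> A (awlast i p)" "x = comp_list f p u" "y = comp_list f p v"
      using xy by (auto simp: piece_def)
    have "dist x y = s ^ path_deg d p * dist u v"
      using similarity_path[OF p(1)] uv(3,4) by (simp add: similarity_map_def)
    also have "\<dots> \<le> s ^ m * D'"
    proof (rule mult_mono)
      show "s ^ path_deg d p \<le> s ^ m"
        using length_le_path_deg[OF p(1)] p(2) s_pos s_less_1 by (intro power_decreasing) auto
      show "dist u v \<le> D'" using D uv(1,2) awlast_verts[OF p(1)] by (force simp: D'_def)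
    qed (use s_pos in auto)
    also have "\<dots> < \<epsilon>" using m by (simp add: D'_def field_simps)
    finally show ?thesis .
  qed
  then show ?thesis by blast
qed

lemma path_to:
  assumes "u \<in> verts G" "v \<in> verts G"
  shows "\<exists>p. path_from u p \<and> awlast u p = v"
proof -
  have "u \<rightarrow>\<^sup>*\<^bsub>G\<^esub> v" using strong assms by (auto simp: strongly_connected_def)
  then obtain p where "awalk u p v" by (auto simp: reachable_awalk)
  then show ?thesis by (auto simp: path_from_def)
qed

lemma bounded_path_to:
  assumes "v \<in> verts G"
  shows "\<exists>L. \<forall>u\<in>verts G. \<exists>p. path_from u p \<and> awlast u p = v \<and> length p \<le> L"
proof -
  obtain p where p: "\<And>u. u \<in> verts G \<Longrightarrow> path_from u (p u) \<and> awlast u (p u) = v"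
    using path_to[OF _ assms] by metis
  have "length (p u) \<le> Max ((\<lambda>u. length (p u)) ` verts G)" if "u \<in> verts G" for u
    using that by (intro Max_ge) auto
  then show ?thesis using p by blast
qed

text \<open>A long initial part of the address of an interior point gives a piece inside the interior;
  strong connectedness closes it up to a loop.\<close>

lemma interior_loop:
  assumes "i \<in> verts G"
  shows "\<exists>p. p \<noteq> [] \<and> path_from i p \<and> awlast i p = i \<and> piece i p \<subseteq> interior (A i)"
proof -
  obtain x where x: "x \<in> interior (A i)" using interior_A[OF assms] by blast
  then obtain \<epsilon> where \<epsilon>: "\<epsilon> > 0" "ball x \<epsilon> \<subseteq> interior (A i)"
    using open_contains_ball open_interior by metis
  obtain m where m: "\<And>p y. path_from i p \<Longrightarrow> length p = m \<Longrightarrow> x \<in> piece i p \<Longrightarrow> y \<in> piece i p \<Longrightarrow> dist x y < \<epsilon>"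
    using pieces_shrink[OF \<epsilon>(1)] by metis
  have xA: "x \<in> A i" using x interior_subset by blast
  obtain p where p: "path_from i p" "length p = m" "x \<in> piece i p"
    using point_address[OF assms xA] by blast
  obtain e where e: "e \<in> out_arcs G (awlast i p)"
    using out_arcs_nonempty[OF awlast_verts[OF p(1)]] by blast
  then obtain q where q: "path_from (head G e) q" "awlast (head G e) q = i"
    using path_to[of "head G e" i] assms by auto
  have path: "path_from i (p @ e # q)" using p(1) e q by (simp add: path_from_append)
  have "piece i (p @ e # q) \<subseteq> piece i p" by (rule piece_antimono[OF path])
  also have "\<dots> \<subseteq> interior (A i)" using m[OF p] \<epsilon>(2) by auto
  finally show ?thesis using path q(2) by (intro exI[of _ "p @ e # q"]) (simp add: awlast_append)
qed

text \<open>The initial parts of the address of a frontier point give pieces that contain it.\<close>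

lemma frontier_path:
  assumes "i \<in> verts G"
  shows "\<exists>p. path_from i p \<and> length p = m \<and> \<not> piece i p \<subseteq> interior (A i)"
proof -
  have "A i \<noteq> interior (A i)"
  proof
    assume eq: "A i = interior (A i)"
    have "open (A i)" by (subst eq) (rule open_interior)
    moreover have "A i \<noteq> {}" using interior_A[OF assms] eq by simp
    ultimately have "A i = UNIV" using clopen compact_A[OF assms] compact_imp_closed by blast
    then show False using compact_A[OF assms] compact_imp_bounded not_bounded_UNIV by metis
  qed
  then obtain x where x: "x \<in> A i" "x \<notin> interior (A i)" using interior_subset by blast
  then show ?thesis using point_address[OF assms x(1), of m] by blast
qed

text \<open>Relative to a higher level, a main supertile is the piece whose path is the part of the
  parameter in between, read backwards.\<close>

lemma supertile_as_piece:
  assumes "is_parameter G \<theta>"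
  shows "supertile \<theta> n = supertile_map \<theta> (n + j) ` piece (param_vertex G \<theta> (n + j)) (rev (map \<theta> [n..<n + j]))"
proof -
  have id: "isometry_map id" by (simp add: isometry_map_def)
  have "region (param_tower id \<theta> n) = region (descend (param_tower id \<theta> (n + j)) (rev (map \<theta> [n..<n + j])))"
    using tower_path[OF tower_param_tower[OF id assms], of n j] by simp
  then show ?thesis
    unfolding region_param_tower region_descend by (simp add: param_tower_def)
qed

lemma supertile_subset_interior_iff:
  assumes "is_parameter G \<theta>" and "param_vertex G \<theta> (n + j) = i" "rev (map \<theta> [n..<n + j]) = p"
  shows "supertile \<theta> n \<subseteq> interior (supertile \<theta> (n + j)) \<longleftrightarrow> piece i p \<subseteq> interior (A i)"
proof -
  let ?g = "supertile_map \<theta> (n + j)"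
  have "interior (?g ` X) = ?g ` interior X" for X
    using interior_image_similarity[OF supertile_map_similarity[OF assms(1), of "n + j"]] s_pos by simp
  then have "interior (supertile \<theta> (n + j)) = ?g ` interior (A i)" using assms(2) by (simp add: supertile_def)
  moreover have "supertile \<theta> n = ?g ` piece i p"
    using supertile_as_piece[OF assms(1), of n j] assms(2,3) by simp
  moreover have "inj ?g" using supertile_map_similarity(2)[OF assms(1)] by (rule bij_is_inj)
  ultimately show ?thesis by (simp add: inj_image_subset_iff)
qed

text \<open>Supertile maps expand distances, so the radius \<open>\<epsilon>\<close> available around a piece does not
  shrink.\<close>

lemma supertile_ball_subset:
  assumes "is_parameter G \<theta>" and "param_vertex G \<theta> (n + j) = i" "rev (map \<theta> [n..<n + j]) = p"
    and ball: "\<And>x. x \<in> piece i p \<Longrightarrow> ball x \<epsilon> \<subseteq> A i" and y: "y \<in> supertile \<theta> n"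
  shows "ball y \<epsilon> \<subseteq> supertile \<theta> (n + j)"
proof
  fix z assume z: "z \<in> ball y \<epsilon>"
  let ?g = "supertile_map \<theta> (n + j)" and ?D = "path_deg d (param_take \<theta> (n + j))"
  note g = supertile_map_similarity[OF assms(1), of "n + j"]
  obtain x where x: "x \<in> piece i p" "y = ?g x"
    using y supertile_as_piece[OF assms(1), of n j] assms(2,3) by auto
  obtain u where u: "z = ?g u" using g(2) by (meson bij_pointE)
  have "dist y z = s powi (- int ?D) * dist x u" using g(1) x(2) u by (simp add: similarity_map_def)
  moreover have "s powi (- int ?D) \<ge> 1"
    using s_pos s_less_1 by (simp add: power_int_minus one_le_inverse power_le_one)
  ultimately have "dist x u \<le> dist y z" by (metis mult_le_cancel_right1 not_less zero_le_dist)
  then have "u \<in> A i" using ball[OF x(1)] z by auto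
  then show "z \<in> supertile \<theta> (n + j)" using u assms(2) by (simp add: supertile_def)
qed

lemma (in -) growing_lists_limit:
  assumes pre: "\<And>k. prefix (W k) (W (Suc k))" and len: "\<And>k. length (W k) < length (W (Suc k))"
  shows "\<exists>\<theta>. \<forall>k. map \<theta> [0..<length (W k)] = W k"
proof -
  have mono: "prefix (W k) (W l)" if "k \<le> l" for k l
    using that by (induction rule: dec_induct) (use pre prefix_order.trans in blast)+
  have ge: "k \<le> length (W k)" for k
  proof (induction k)
    case (Suc k)
    then show ?case using len[of k] by simp
  qed simp
  have nth: "W k ! j = W l ! j" if "k \<le> l" "j < length (W k)" for k l j
    using mono[OF that(1)] that(2) by (auto simp: prefix_def nth_append)
  have "map (\<lambda>j. W (Suc j) ! j) [0..<length (W k)] = W k" for k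
  proof (rule nth_equalityI)
    fix j assume "j < length (map (\<lambda>j. W (Suc j) ! j) [0..<length (W k)])"
    then have j: "j < length (W k)" by simp
    have "j < length (W (Suc j))" using ge[of "Suc j"] by simp
    then have "W (Suc j) ! j = W k ! j"
      using nth[OF _ j, of "Suc j"] nth[of "Suc j" k j] by (metis nle_le)
    then show "map (\<lambda>j. W (Suc j) ! j) [0..<length (W k)] ! j = W k ! j" using j by simp
  qed simp
  then show ?thesis by blast
qed

lemma parameter_of_paths:
  assumes path: "\<And>k. \<exists>n\<ge>k. path_from i (rev (map \<theta> [0..<n]))"
  shows "is_parameter G \<theta>"
  unfolding is_parameter_def is_inf_path_def
proof
  fix j
  obtain n where n: "n \<ge> Suc (Suc j)" "path_from i (rev (map \<theta> [0..<n]))" using path by blast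
  have "[0..<n] = [0..<j] @ [j, Suc j] @ [Suc (Suc j)..<n]"
    using n(1) upt_add_eq_append[of 0 j "n - j"] by (simp add: upt_conv_Cons)
  then have "rev (map \<theta> [0..<n]) = rev (map \<theta> [Suc (Suc j)..<n]) @ [\<theta> (Suc j), \<theta> j] @ rev (map \<theta> [0..<j])"
    by simp
  then have "path_from (awlast i (rev (map \<theta> [Suc (Suc j)..<n]))) ([\<theta> (Suc j), \<theta> j] @ rev (map \<theta> [0..<j]))"
    using n(2) path_from_append by simp
  then show "\<theta> j \<in> arcs (reverse_digraph G) \<and>
      head (reverse_digraph G) (\<theta> j) = tail (reverse_digraph G) (\<theta> (Suc j))"
    by (simp add: reverse_digraph_def)
qed

lemma param_vertex_of_path:
  assumes "path_from i (rev (map \<theta> [0..<n]))" "n > 0"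
  shows "param_vertex G \<theta> n = i"
proof -
  obtain n' where "n = Suc n'" using assms(2) gr0_conv_Suc by blast
  then show ?thesis using assms(1) by (simp add: param_vertex_def reverse_digraph_def)
qed

section \<open>Slowly escaping filling parameters\<close>

text \<open>Each step of the chain adds a layer of fixed thickness.\<close>

lemma exhausting_if_balls_nested:
  assumes "\<epsilon> > 0" and param: "is_parameter G \<theta>"
    and ball: "\<And>k y. y \<in> supertile \<theta> (l k) \<Longrightarrow> ball y \<epsilon> \<subseteq> supertile \<theta> (l (Suc k))"
  shows "(\<Union>k. supertile \<theta> k) = UNIV"
proof -
  define \<delta> where "\<delta> = \<epsilon> / 2"
  have \<delta>: "\<delta> > 0" "\<delta> < \<epsilon>" using assms(1) by (auto simp: \<delta>_def)
  have "A (param_vertex G \<theta> (l 0)) \<noteq> {}"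
    using interior_A[of "param_vertex G \<theta> (l 0)"] parameter_arc(2)[OF param, of "l 0"]
      parameter_arc(1)[OF param, of "l 0"] head_in_verts by fastforce
  then obtain y0 where y0: "y0 \<in> supertile \<theta> (l 0)" by (auto simp: supertile_def)
  have cball: "cball y0 (real k * \<delta>) \<subseteq> supertile \<theta> (l k)" for k
  proof (induction k)
    case 0
    then show ?case using y0 by simp
  next
    case (Suc k)
    show ?case
    proof
      fix z assume "z \<in> cball y0 (real (Suc k) * \<delta>)"
      then have z: "norm (z - y0) \<le> real (Suc k) * \<delta>" by (simp add: dist_norm norm_minus_commute)
      define y where "y = y0 + (real k / real (Suc k)) *\<^sub>R (z - y0)"
      have "dist y0 y = real k / real (Suc k) * norm (z - y0)" by (simp add: y_def dist_norm)
      also have "\<dots> \<le> real k / real (Suc k) * (real (Suc k) * \<delta>)" using z by (intro mult_left_mono) auto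
      also have "\<dots> = real k * \<delta>" by simp
      finally have "y \<in> supertile \<theta> (l k)" using Suc.IH by auto
      have "z - y = (1 - real k / real (Suc k)) *\<^sub>R (z - y0)" by (simp add: y_def algebra_simps)
      also have "1 - real k / real (Suc k) = 1 / real (Suc k)" by (simp add: field_simps)
      finally have "norm (z - y) = norm (z - y0) / real (Suc k)" by simp
      then have "dist y z = norm (z - y0) / real (Suc k)" by (simp add: dist_norm norm_minus_commute)
      also have "\<dots> \<le> \<delta>" using z by (simp add: field_simps)
      finally have "z \<in> ball y \<epsilon>" using \<delta> by simp
      then show "z \<in> supertile \<theta> (l (Suc k))" using ball[OF \<open>y \<in> supertile \<theta> (l k)\<close>] by blast
    qed
  qed
  have "z \<in> (\<Union>k. supertile \<theta> k)" for z
  proof -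
    obtain k where "dist y0 z < real k * \<delta>" using reals_Archimedean3[OF \<delta>(1)] by blast
    then have "z \<in> supertile \<theta> (l k)" using cball[of k] by auto
    then show ?thesis by blast
  qed
  then show ?thesis by blast
qed

text \<open>The second conclusion says more than filling: an increasing union of closed sets can be the
  whole space although a point stays on their frontiers. It is what makes the speed of escape
  finite.

  The parameter is a concatenation of blocks, each of which, read backwards, is a loop at \<open>i\<close>
  of the form \<open>\<tau> \<rho> \<sigma>\<close>: \<open>\<tau>\<close> is part of a frontier address, \<open>\<rho>\<close> leads from its end back
  to \<open>i\<close>, and \<open>\<sigma>\<close> is a loop into the interior. The supertile at the end of \<open>\<tau>\<close> remains at the
  frontier for \<open>length \<tau>\<close> levels.\<close>

lemma slowly_escaping_parameter:
  fixes g :: "nat \<Rightarrow> nat"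
  shows "\<exists>\<theta>. is_filling G f A \<theta> \<and> (\<forall>j. \<exists>r. supertile \<theta> j \<subseteq> interior (supertile \<theta> (j + r))) \<and>
    (\<forall>N. \<exists>j\<ge>N. \<not> supertile \<theta> j \<subseteq> interior (supertile \<theta> (j + g j)))"
proof -
  obtain i where i: "i \<in> verts G" using strong by (auto simp: strongly_connected_def)
  obtain \<sigma> where \<sigma>: "\<sigma> \<noteq> []" "path_from i \<sigma>" "awlast i \<sigma> = i" "piece i \<sigma> \<subseteq> interior (A i)"
    using interior_loop[OF i] by blast
  obtain L where L: "\<And>u. u \<in> verts G \<Longrightarrow> \<exists>p. path_from u p \<and> awlast u p = i \<and> length p \<le> L"
    using bounded_path_to[OF i] by blast
  \<comment> \<open>The level at which \<open>\<tau>\<close> starts depends on the length of \<open>\<rho>\<close>, hence on \<open>\<tau>\<close> itself; the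
    bound \<open>L\<close> permits a length of \<open>\<tau>\<close> that is enough for all possible levels.\<close>
  define m where "m n = Max (g ` {n..n + L})" for n
  have m: "g (n + r) \<le> m n" if "r \<le> L" for n r
    unfolding m_def using that by (intro Max_ge) auto
  have "\<exists>p q. path_from i (p @ q) \<and> awlast i (p @ q) = i \<and> length p = k \<and> length q \<le> L \<and>
      \<not> piece i p \<subseteq> interior (A i)" for k
  proof -
    obtain p where p: "path_from i p" "length p = k" "\<not> piece i p \<subseteq> interior (A i)"
      using frontier_path[OF i] by blast
    then show ?thesis using L[OF awlast_verts[OF p(1)]] by (force simp: path_from_append awlast_append)
  qed
  then obtain \<tau> \<rho> where \<tau>\<rho>: "\<And>k. path_from i (\<tau> k @ \<rho> k)" "\<And>k. awlast i (\<tau> k @ \<rho> k) = i"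
    "\<And>k. length (\<tau> k) = k" "\<And>k. length (\<rho> k) \<le> L" "\<And>k. \<not> piece i (\<tau> k) \<subseteq> interior (A i)"
    by metis
  define T where "T w = \<tau> (m (length w + length \<sigma>))" for w :: "'e list"
  define R where "R w = \<rho> (m (length w + length \<sigma>))" for w :: "'e list"
  have TR: "path_from i (T w @ R w)" "awlast i (T w @ R w) = i" "length (T w) = m (length w + length \<sigma>)"
    "length (R w) \<le> L" "\<not> piece i (T w) \<subseteq> interior (A i)" for w
    using \<tau>\<rho> by (simp_all add: T_def R_def)
  define W where "W = rec_nat [] (\<lambda>_ w. w @ rev (T w @ R w @ \<sigma>))"
  have W: "W 0 = []" "W (Suc k) = W k @ rev \<sigma> @ rev (R (W k)) @ rev (T (W k))" for k
    by (simp_all add: W_def)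
  obtain \<theta> where \<theta>: "\<And>k. map \<theta> [0..<length (W k)] = W k"
    using growing_lists_limit[of W] \<sigma>(1) W(2) by auto
  have Wpath: "path_from i (rev (W k)) \<and> awlast i (rev (W k)) = i" for k
  proof (induction k)
    case (Suc k)
    have "rev (W (Suc k)) = (T (W k) @ R (W k)) @ \<sigma> @ rev (W k)" by (simp add: W)
    then show ?case using Suc TR(1,2)[of "W k"] \<sigma>(2,3) by (simp only: path_from_append awlast_append)
  qed (simp add: W i)
  have len: "k \<le> length (W k)" for k
  proof (induction k)
    case (Suc k)
    then show ?case using \<sigma>(1) by (cases \<sigma>) (auto simp: W)
  qed simp
  have param: "is_parameter G \<theta>"
  proof (rule parameter_of_paths)
    show "\<exists>n\<ge>k. path_from i (rev (map \<theta> [0..<n]))" for k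
      using len[of k] \<theta>[of k] Wpath[of k] by metis
  qed
  \<comment> \<open>Block \<open>k\<close> occupies the levels from \<open>a k\<close> to \<open>a (Suc k)\<close>: first \<open>\<sigma>\<close>, then from level \<open>b k\<close>
    the path \<open>\<rho>\<close>, and from level \<open>c k\<close> the frontier path.\<close>
  define a where "a k = length (W k)" for k
  define b where "b k = a k + length \<sigma>" for k
  define c where "c k = b k + length (R (W k))" for k
  have a_Suc: "a (Suc k) = c k + length (T (W k))" for k
    by (simp add: a_def b_def c_def W)
  have seg: "map \<theta> [0..<a (Suc k)] = map \<theta> [0..<a k] @ rev \<sigma> @ rev (R (W k)) @ rev (T (W k))" for k
    unfolding a_def \<theta> by (rule W(2))
  have seg_b: "map \<theta> [0..<b k] = map \<theta> [0..<a k] @ rev \<sigma>" "rev (map \<theta> [a k..<a k + length \<sigma>]) = \<sigma>" for k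
  proof -
    have "map \<theta> [0..<b k] = take (b k) (map \<theta> [0..<a (Suc k)])"
      by (simp add: take_map take_upt a_Suc c_def)
    then show *: "map \<theta> [0..<b k] = map \<theta> [0..<a k] @ rev \<sigma>" unfolding seg by (simp add: b_def)
    have "map \<theta> [a k..<b k] = drop (a k) (map \<theta> [0..<b k])" by (simp add: drop_map)
    then show "rev (map \<theta> [a k..<a k + length \<sigma>]) = \<sigma>" unfolding * by (simp add: b_def)
  qed
  have seg_c: "rev (map \<theta> [c k..<c k + length (T (W k))]) = T (W k)" for k
  proof -
    have "map \<theta> [c k..<a (Suc k)] = drop (c k) (map \<theta> [0..<a (Suc k)])" by (simp add: drop_map)
    then have "map \<theta> [c k..<a (Suc k)] = rev (T (W k))" unfolding seg by (simp add: c_def b_def)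
    then show ?thesis by (simp only: a_Suc[symmetric] rev_rev_ident)
  qed
  have vb: "param_vertex G \<theta> (a k + length \<sigma>) = i" for k
  proof (rule param_vertex_of_path)
    have "rev (map \<theta> [0..<a k + length \<sigma>]) = \<sigma> @ rev (W k)"
      using seg_b(1)[of k] \<theta>[of k] by (simp add: b_def a_def)
    then show "path_from i (rev (map \<theta> [0..<a k + length \<sigma>]))"
      using Wpath[of k] \<sigma>(2,3) by (simp only: path_from_append)
    show "0 < a k + length \<sigma>" using \<sigma>(1) by simp
  qed
  have vc: "param_vertex G \<theta> (c k + length (T (W k))) = i" for k
  proof (rule param_vertex_of_path)
    show "path_from i (rev (map \<theta> [0..<c k + length (T (W k))]))"
      using Wpath[of "Suc k"] \<theta>[of "Suc k"] by (simp add: a_Suc[symmetric] a_def)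
    show "0 < c k + length (T (W k))" using \<sigma>(1) by (simp add: c_def b_def)
  qed
  have inner: "supertile \<theta> (a k) \<subseteq> interior (supertile \<theta> (a k + length \<sigma>))" for k
    using supertile_subset_interior_iff[OF param vb seg_b(2)] \<sigma>(4) by blast
  have slow: "\<not> supertile \<theta> (c k) \<subseteq> interior (supertile \<theta> (c k + g (c k)))" for k
  proof -
    have "g (c k) \<le> length (T (W k))"
      unfolding TR(3) c_def b_def a_def using m[OF TR(4)] by simp
    then have "interior (supertile \<theta> (c k + g (c k))) \<subseteq> interior (supertile \<theta> (c k + length (T (W k))))"
      by (intro interior_mono supertile_mono[OF param]) simp
    then show ?thesis using supertile_subset_interior_iff[OF param vc seg_c] TR(5) by blast
  qed
  have escape: "\<exists>r. supertile \<theta> j \<subseteq> interior (supertile \<theta> (j + r))" for j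
  proof -
    have "j \<le> a j" using len by (simp add: a_def)
    then have "supertile \<theta> j \<subseteq> interior (supertile \<theta> (a j + length \<sigma>))"
      using supertile_mono[OF param, of j "a j"] inner[of j] by blast
    moreover have "a j + length \<sigma> = j + (a j + length \<sigma> - j)" using \<open>j \<le> a j\<close> by simp
    ultimately show ?thesis by metis
  qed
  have "compact (piece i \<sigma>)"
    using compact_A[OF i] similarity_continuous[OF similarity_path[OF \<sigma>(2)]] s_pos
    unfolding piece_def \<sigma>(3) by (intro compact_continuous_image) auto
  then obtain \<epsilon> where "\<epsilon> > 0" and nbhd: "(\<Union>x\<in>piece i \<sigma>. ball x \<epsilon>) \<subseteq> interior (A i)"
    using compact_subset_open_imp_ball_epsilon_subset[OF _ open_interior \<sigma>(4)] by blast
  then have eps: "ball x \<epsilon> \<subseteq> A i" if "x \<in> piece i \<sigma>" for x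
    using that interior_subset by blast
  have up: "a k + length \<sigma> \<le> a (Suc k)" for k by (simp add: a_Suc c_def b_def)
  have "(\<Union>k. supertile \<theta> k) = UNIV"
  proof (rule exhausting_if_balls_nested[OF \<open>\<epsilon> > 0\<close> param])
    show "ball y \<epsilon> \<subseteq> supertile \<theta> (a (Suc k))" if "y \<in> supertile \<theta> (a k)" for k y
      using supertile_ball_subset[OF param vb seg_b(2) eps that] supertile_mono[OF param up] by blast
  qed
  then have "is_filling G f A \<theta>" by (rule filling_if_supertiles_exhaust[OF param])
  moreover have "k \<le> c k" for k using len[of k] by (simp add: c_def b_def a_def)
  ultimately show ?thesis using slow escape by blast
qed

section \<open>The diagonal argument\<close>

text \<open>The classes that are enumerated are those of parameters with a finite speed of escape. Their
  representatives can then be chosen with a finite speed, which is what the diagonal sequence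
  dominates.\<close>

theorem uncountable_congruence_classes:
  assumes rigid: "is_rigid G f A s"
  shows "uncountable ({balanced_tiling G f A d \<theta> | \<theta>. is_filling G f A \<theta>} // {(T, T'). congruent_sets T T'})"
    (is "uncountable (?X // ?R)")
proof
  assume count: "countable (?X // ?R)"
  define \<Theta> where "\<Theta> = {\<theta>. is_filling G f A \<theta> \<and> (\<forall>j. \<exists>r. supertile \<theta> j \<subseteq> interior (supertile \<theta> (j + r)))}"
  define cls where "cls \<theta> = ?R `` {balanced_tiling G f A d \<theta>}" for \<theta>
  have "cls ` \<Theta> \<subseteq> ?X // ?R" unfolding cls_def \<Theta>_def quotient_def by blast
  then have C: "countable (cls ` \<Theta>)" using count countable_subset by blast
  obtain \<theta>0 where "\<theta>0 \<in> \<Theta>" using slowly_escaping_parameter[of "\<lambda>_. 0"] unfolding \<Theta>_def by blast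
  then have ne: "cls ` \<Theta> \<noteq> {}" by blast
  define t where "t n = inv_into \<Theta> cls (from_nat_into (cls ` \<Theta>) n)" for n
  have t: "t n \<in> \<Theta>" for n
    unfolding t_def using from_nat_into[OF ne] by (rule inv_into_into)
  have cover: "\<exists>n. congruent_sets (balanced_tiling G f A d (t n)) (balanced_tiling G f A d \<theta>)" if "\<theta> \<in> \<Theta>" for \<theta>
  proof -
    obtain n where n: "from_nat_into (cls ` \<Theta>) n = cls \<theta>"
      using from_nat_into_surj[OF C] \<open>\<theta> \<in> \<Theta>\<close> by blast
    then have "cls (t n) = cls \<theta>"
      unfolding t_def using f_inv_into_f[of "cls \<theta>" cls \<Theta>] \<open>\<theta> \<in> \<Theta>\<close> by simp
    moreover have "congruent_sets T T" for T :: "'a set set"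
      unfolding congruent_sets_def isometry_map_def by (intro exI[of _ id]) simp
    then have "balanced_tiling G f A d \<theta> \<in> cls \<theta>" by (simp add: cls_def)
    ultimately show ?thesis by (auto simp: cls_def)
  qed
  obtain h where h: "\<And>n j. supertile (t n) j \<subseteq> interior (supertile (t n) (j + h n j))"
    using t unfolding \<Theta>_def by (simp, metis)
  \<comment> \<open>Besides the representative \<open>n\<close>, the index \<open>N\<close> codes the shift from its levels \<open>m + r\<close> to
    the levels \<open>m' + r\<close> of a congruent tiling; \<open>g\<close> eventually dominates each \<open>F N\<close>.\<close>
  define F where "F N j = (case prod_decode N of (n, M) \<Rightarrow> case prod_decode M of (m, m') \<Rightarrow>
    h n (m + (j - m')))" for N j
  define g where "g j = Max ((\<lambda>N. F N j) ` {..j})" for j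
  obtain \<theta> where \<theta>: "is_filling G f A \<theta>" "\<And>j. \<exists>r. supertile \<theta> j \<subseteq> interior (supertile \<theta> (j + r))"
    "\<And>N. \<exists>j\<ge>N. \<not> supertile \<theta> j \<subseteq> interior (supertile \<theta> (j + g j))"
    using slowly_escaping_parameter[of g] by blast
  then have "\<theta> \<in> \<Theta>" by (simp add: \<Theta>_def)
  then obtain n where "congruent_sets (balanced_tiling G f A d (t n)) (balanced_tiling G f A d \<theta>)"
    using cover by blast
  moreover have param: "is_parameter G \<theta>" "is_parameter G (t n)"
    using \<theta>(1) t[of n] by (simp_all add: \<Theta>_def is_filling_def)
  ultimately obtain U m m' where U: "isometry_map U"
    and merge: "\<And>r. U ` supertile (t n) (m + r) = supertile \<theta> (m' + r)"
    using congruent_balanced_tilings_merge[OF rigid param(2,1)] by blast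
  define N where "N = prod_encode (n, prod_encode (m, m'))"
  obtain j where j: "j \<ge> max N m'" "\<not> supertile \<theta> j \<subseteq> interior (supertile \<theta> (j + g j))"
    using \<theta>(3) by blast
  define r where "r = j - m'"
  have jr: "j = m' + r" using j(1) by (simp add: r_def)
  have FN: "F N j = h n (m + r)" by (simp add: F_def N_def r_def)
  have "F N j \<le> g j" unfolding g_def using j(1) by (intro Max_ge) auto
  have intU: "interior (U ` X) = U ` interior X" for X
    using U isometry_map_bij[OF U] interior_image_similarity[of 1 U X]
    by (simp add: isometry_map_def similarity_map_def)
  have "supertile \<theta> j \<subseteq> U ` interior (supertile (t n) (m + r + h n (m + r)))"
    unfolding jr merge[symmetric] using h by (rule image_mono)
  also have "\<dots> = interior (supertile \<theta> (j + F N j))"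
    unfolding intU[symmetric] FN using merge[of "r + h n (m + r)"] by (simp add: jr add.assoc)
  also have "\<dots> \<subseteq> interior (supertile \<theta> (j + g j))"
    using \<open>F N j \<le> g j\<close> by (intro interior_mono supertile_mono[OF param(1)]) simp
  finally show False using j(2) by contradiction
qed

end

theorem theorem9:
  fixes G :: "(nat, 'e) pre_digraph"
    and n :: nat
    and f :: "'e \<Rightarrow> real ^ 'n \<Rightarrow> real ^ 'n"
    and A :: "nat \<Rightarrow> (real ^ 'n) set"
    and s :: real
    and d :: "'e \<Rightarrow> nat"
  assumes "is_gifs G n f"
    and "is_attractor G f A"
    and "tile_conditions G f A"
    and "s > 0"
    and "\<forall>e\<in>arcs G. d e > 0"
    and "\<forall>e\<in>arcs G. similarity_map (s ^ d e) (f e)"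
    and "is_rigid G f A s"
  shows "uncountable
    ({balanced_tiling G f A d \<theta> | \<theta>. is_filling G f A \<theta>} // {(T, T'). congruent_sets T T'})"
proof -
  have G: "fin_digraph G" "strongly_connected G" "\<And>e. e \<in> arcs G \<Longrightarrow> bij (f e) \<and> contraction_map (f e)"
    using assms(1) by (auto simp: is_gifs_def)
  have "s < 1"
  proof -
    obtain i where "i \<in> verts G" using G(2) by (auto simp: strongly_connected_def)
    then have "A i \<noteq> {}" "A i = (\<Union>e\<in>out_arcs G i. f e ` A (head G e))"
      using assms(2) unfolding is_attractor_def by blast+
    then obtain e where e: "e \<in> arcs G" by fastforce
    then obtain c where c: "c < 1" "c-lipschitz_on UNIV (f e)"
      using G(3) by (auto simp: contraction_map_def)
    obtain b :: "real ^ 'n" where "b \<in> Basis" using nonempty_Basis by blast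
    then have b: "dist b 0 = 1" by simp
    have "s ^ d e * dist b 0 = dist (f e b) (f e 0)" using assms(6) e by (simp add: similarity_map_def)
    also have "\<dots> \<le> c * dist b 0" using c(2) by (rule lipschitz_onD) auto
    finally have "s ^ d e < 1" using b c(1) by simp
    then show ?thesis using one_le_power[of s "d e"] by (meson not_le)
  qed
  then have "balanced_gifs G f A s d"
    using G assms(2-6) by (intro balanced_gifs.intro balanced_gifs_axioms.intro) auto
  then show ?thesis using assms(7) by (rule balanced_gifs.uncountable_congruence_classes)
qed

end
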